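(* Let $H=H_0+V$ where $V$ is $(\Gamma,\mathcal M)$ pseudo-ergodic and $\mathcal M$ contains more than one point. Then $H$ has no inessential spectrum, i.e. every $\lambda\in\mathrm{Spec}(H)$ lies in the essential spectrum of $H$.
   Context: $X$ is a countable set on which a group $\Gamma$ acts by permutations, $\mathcal K$ is a complex Hilbert space, and operators act on $l^2(X,\mathcal K)\cong l^2(X)\otimes\mathcal K$. For $\gamma\in\Gamma$ the unitary $U_\gamma$ is $(U_\gamma f)(x)=f(\gamma^{-1}x)$. $H_0$ is a bounded operator on $l^2(X)$ with $H_0U_\gamma=U_\gamma H_0$ for all $\gamma\in\Gamma$; the operator $H_0\otimes I$ on $l^2(X,\mathcal K)$ is also written $H_0$. $\mathcal M\subseteq\mathcal L(\mathcal K)$ (bounded operators on $\mathcal K$) is a norm closed, bounded set. A function $V:X\to\mathcal M$ is identified with the bounded operator $(Vf)(x)=V(x)f(x)$. A potential $V:X\to\mathcal M$ is $(\Gamma,\mathcal M)$ pseudo-ergodic if for every $\varepsilon>0$, every finite $F\subset X$ and every $W:F\to\mathcal M$ there exists $\gamma\in\Gamma$ such that $\|W(x)-V(\gamma x)\|<\varepsilon$ for all $x\in F$. The essential spectrum of a bounded operator $A$ is the set of $z\in\mathbf C$ such that $A-zI$ is not a Fredholm operator. *)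

theory Defs
  imports "HOL-Analysis.Analysis" "HOL-Algebra.Group_Action"
begin

section \<open>Complex Hilbert spaces\<close>

class complex_vector = real_vector +
  fixes scaleC :: "complex \<Rightarrow> 'a \<Rightarrow> 'a"  (infixr "*\<^sub>C" 75)
  assumes scaleC_add_right: "a *\<^sub>C (x + y) = a *\<^sub>C x + a *\<^sub>C y"
    and scaleC_add_left: "(a + b) *\<^sub>C x = a *\<^sub>C x + b *\<^sub>C x"
    and scaleC_scaleC [simp]: "a *\<^sub>C b *\<^sub>C x = (a * b) *\<^sub>C x"
    and scaleC_of_real: "complex_of_real r *\<^sub>C x = r *\<^sub>R x"

text \<open>The inner product is linear in the second argument. The axiom \<open>cinner_self\<close> comprises
  positive definiteness and says that the norm is the one induced by the inner product.\<close>

class complex_inner = real_normed_vector + complex_vector +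
  fixes cinner :: "'a \<Rightarrow> 'a \<Rightarrow> complex"
  assumes cinner_commute: "cinner x y = cnj (cinner y x)"
    and cinner_add_right: "cinner x (y + z) = cinner x y + cinner x z"
    and cinner_scaleC_right: "cinner x (a *\<^sub>C y) = a * cinner x y"
    and cinner_self: "cinner x x = complex_of_real ((norm x)\<^sup>2)"

class chilbert_space = complex_inner + banach

instantiation complex :: chilbert_space
begin

definition "scaleC_complex (a::complex) (x::complex) = a * x"
definition "cinner_complex (x::complex) (y::complex) = cnj x * y"

instance
proof
  fix x y z a b :: complex and r :: real
  show "a *\<^sub>C (x + y) = a *\<^sub>C x + a *\<^sub>C y" "(a + b) *\<^sub>C x = a *\<^sub>C x + b *\<^sub>C x"
    "a *\<^sub>C b *\<^sub>C x = (a * b) *\<^sub>C x" "complex_of_real r *\<^sub>C x = r *\<^sub>R x"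
    by (simp_all add: scaleC_complex_def algebra_simps scaleR_conv_of_real)
  show "cinner x y = cnj (cinner y x)" "cinner x (y + z) = cinner x y + cinner x z"
    "cinner x (a *\<^sub>C y) = a * cinner x y"
    by (simp_all add: cinner_complex_def scaleC_complex_def algebra_simps)
  show "cinner x x = complex_of_real ((norm x)\<^sup>2)"
    using complex_norm_square[of x] by (simp add: cinner_complex_def mult.commute)
qed

end

lemma scaleC_one [simp]: "1 *\<^sub>C x = (x::'a::complex_vector)"
  using scaleC_of_real[of 1 x] by simp

global_interpretation complex_vector:
  vector_space "scaleC :: complex \<Rightarrow> 'a \<Rightarrow> 'a::complex_vector"
  defines cspan = complex_vector.span
  by unfold_locales (simp_all add: scaleC_add_right scaleC_add_left)

lemma cinner_add_left: "cinner (x + y) z = cinner x z + cinner y (z::'a::complex_inner)"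
  by (metis cinner_add_right cinner_commute complex_cnj_add)

lemma cinner_scaleC_left: "cinner (a *\<^sub>C x) y = cnj a * cinner x (y::'a::complex_inner)"
  by (metis cinner_scaleC_right cinner_commute complex_cnj_mult)

lemma cinner_zero_right [simp]: "cinner x (0::'a::complex_inner) = 0"
  using cinner_add_right[of x 0 0] by simp

lemma cinner_zero_left [simp]: "cinner (0::'a::complex_inner) x = 0"
  using cinner_add_left[of 0 0 x] by simp

lemma cinner_minus_right: "cinner x (- y) = - cinner x (y::'a::complex_inner)"
  using cinner_add_right[of x y "- y"] by (simp add: eq_neg_iff_add_eq_0 add.commute)

lemma cinner_diff_right: "cinner x (y - z) = cinner x y - cinner x (z::'a::complex_inner)"
  using cinner_add_right[of x y "- z"] by (simp add: cinner_minus_right)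

lemma cinner_sum_right: "cinner x (sum f A) = (\<Sum>i\<in>A. cinner x (f i :: 'a::complex_inner))"
  by (induction A rule: infinite_finite_induct) (simp_all add: cinner_add_right)

lemma cinner_sum_left: "cinner (sum f A) x = (\<Sum>i\<in>A. cinner (f i :: 'a::complex_inner) x)"
  by (induction A rule: infinite_finite_induct) (simp_all add: cinner_add_left)

lemma norm_scaleC [simp]: "norm (a *\<^sub>C x) = norm a * norm (x::'a::complex_inner)"
proof -
  have "complex_of_real ((norm (a *\<^sub>C x))\<^sup>2) = cnj a * a * complex_of_real ((norm x)\<^sup>2)"
    by (simp only: cinner_self[symmetric] cinner_scaleC_left cinner_scaleC_right mult.assoc mult.left_commute)
  also have "\<dots> = complex_of_real ((norm a * norm x)\<^sup>2)"
    by (simp add: power_mult_distrib complex_norm_square mult.commute del: of_real_power)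
  finally have "(norm (a *\<^sub>C x))\<^sup>2 = (norm a * norm x)\<^sup>2"
    using of_real_eq_iff by blast
  then show ?thesis by (simp add: power2_eq_iff_nonneg)
qed

lemma norm_add_sq:
  "(norm (x + y))\<^sup>2 = (norm x)\<^sup>2 + (norm y)\<^sup>2 + 2 * Re (cinner x (y::'a::complex_inner))"
proof -
  have "complex_of_real ((norm (x + y))\<^sup>2)
      = complex_of_real ((norm x)\<^sup>2) + complex_of_real ((norm y)\<^sup>2) + (cinner x y + cnj (cinner x y))"
    by (simp only: cinner_self[symmetric] cinner_add_left cinner_add_right cinner_commute[of y x]) simp
  also have "\<dots> = complex_of_real ((norm x)\<^sup>2 + (norm y)\<^sup>2 + 2 * Re (cinner x y))"
    by (simp add: complex_add_cnj)
  finally show ?thesis using of_real_eq_iff by blast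
qed

lemma norm_cinner_le: "norm (cinner x y) \<le> norm x * norm (y::'a::complex_inner)"
proof (cases "y = 0")
  case False
  define t where "t = - (cnj (cinner x y) / complex_of_real ((norm y)\<^sup>2))"
  have y: "norm y > 0" using False by simp
  have "0 \<le> (norm (x + t *\<^sub>C y))\<^sup>2" by simp
  also have "\<dots> = (norm x)\<^sup>2 + (norm t * norm y)\<^sup>2 + 2 * Re (t * cinner x y)"
    by (simp add: norm_add_sq cinner_scaleC_right)
  also have "norm t = norm (cinner x y) / (norm y)\<^sup>2"
    by (simp add: t_def norm_divide norm_power)
  also have "t * cinner x y = - complex_of_real ((norm (cinner x y))\<^sup>2 / (norm y)\<^sup>2)"
    by (simp add: t_def complex_norm_square mult.commute del: of_real_power)
  finally have "0 \<le> (norm x)\<^sup>2 - (norm (cinner x y))\<^sup>2 / (norm y)\<^sup>2"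
    using y by (simp add: power2_eq_square field_simps)
  then have "(norm (cinner x y))\<^sup>2 \<le> (norm x * norm y)\<^sup>2"
    using y by (simp add: field_simps power_mult_distrib)
  then show ?thesis by (rule power2_le_imp_le) simp
qed simp


section \<open>Bounded operators, spectrum and essential spectrum\<close>

definition bounded_clinear :: "('a::complex_inner \<Rightarrow> 'b::complex_inner) \<Rightarrow> bool" where
  "bounded_clinear A \<longleftrightarrow> bounded_linear A \<and> (\<forall>c x. A (c *\<^sub>C x) = c *\<^sub>C A x)"

text \<open>The algebra of bounded complex linear operators, as a subspace of the normed space of
  bounded real linear operators; the norm is the operator norm in either case.\<close>

definition bounded_operators :: "('a::complex_inner \<Rightarrow>\<^sub>L 'a) set" where
  "bounded_operators = {A. bounded_clinear (blinfun_apply A)}"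

definition spectrum :: "('a::complex_inner \<Rightarrow> 'a) \<Rightarrow> complex set" where
  "spectrum A = {z. \<not> (\<exists>B. bounded_clinear B \<and>
     (\<forall>f. B (A f - z *\<^sub>C f) = f) \<and> (\<forall>f. A (B f) - z *\<^sub>C B f = f))}"

text \<open>Finite-dimensional kernel, closed range, and range of finite codimension.\<close>

definition fredholm :: "('a::complex_inner \<Rightarrow> 'b::complex_inner) \<Rightarrow> bool" where
  "fredholm A \<longleftrightarrow> bounded_clinear A \<and>
     (\<exists>S. finite S \<and> {f. A f = 0} \<subseteq> cspan S) \<and>
     closed (range A) \<and>
     (\<exists>S. finite S \<and> (\<forall>g. \<exists>f. g - A f \<in> cspan S))"

definition essential_spectrum :: "('a::complex_inner \<Rightarrow> 'a) \<Rightarrow> complex set" where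
  "essential_spectrum A = {z. \<not> fredholm (\<lambda>f. A f - z *\<^sub>C f)}"


section \<open>The Hilbert space of square summable functions\<close>

definition square_summable :: "('x \<Rightarrow> 'k::real_normed_vector) \<Rightarrow> bool" where
  "square_summable f \<longleftrightarrow> (\<lambda>x. (norm (f x))\<^sup>2) summable_on UNIV"

lemma L2_set_le_ell2_norm:
  assumes "square_summable f" "finite F"
  shows "L2_set (\<lambda>x. norm (f x)) F \<le> sqrt (\<Sum>\<^sub>\<infinity>x. (norm (f x))\<^sup>2)"
  unfolding L2_set_def using assms
  by (intro real_sqrt_le_mono finite_sum_le_infsum) (auto simp: square_summable_def)

lemma square_summableI:
  assumes "\<And>F. finite F \<Longrightarrow> L2_set (\<lambda>x. norm (f x)) F \<le> B"
  shows "square_summable f"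
proof -
  have B: "0 \<le> B" using assms[of "{}"] by simp
  have "(\<Sum>x\<in>F. (norm (f x))\<^sup>2) \<le> B\<^sup>2" if "finite F" for F
    using assms[OF that] B by (simp add: L2_set_def sqrt_le_D)
  then show ?thesis unfolding square_summable_def
    by (intro nonneg_bdd_above_summable_on) (auto simp: bdd_above_def)
qed

lemma ell2_norm_leI:
  assumes "\<And>F. finite F \<Longrightarrow> L2_set (\<lambda>x. norm (f x)) F \<le> B"
  shows "sqrt (\<Sum>\<^sub>\<infinity>x. (norm (f x))\<^sup>2) \<le> B"
proof -
  have B: "0 \<le> B" using assms[of "{}"] by simp
  have "(\<Sum>x\<in>F. (norm (f x))\<^sup>2) \<le> B\<^sup>2" if "finite F" for F
    using assms[OF that] B by (simp add: L2_set_def sqrt_le_D)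
  then have "(\<Sum>\<^sub>\<infinity>x. (norm (f x))\<^sup>2) \<le> B\<^sup>2"
    using square_summableI[OF assms]
    by (intro infsum_le_finite_sums) (auto simp: square_summable_def)
  then show ?thesis using B by (simp add: real_le_lsqrt infsum_nonneg)
qed

lemma L2_set_norm_add_le:
  "L2_set (\<lambda>x. norm (f x + g x)) F \<le> L2_set (\<lambda>x. norm (f x)) F + L2_set (\<lambda>x. norm (g x)) F"
  by (rule order_trans[OF L2_set_mono L2_set_triangle_ineq]) (auto intro: norm_triangle_ineq)

lemma square_summable_zero: "square_summable (\<lambda>_. 0)"
  by (simp add: square_summable_def)

lemma square_summable_add:
  assumes "square_summable f" "square_summable g"
  shows "square_summable (\<lambda>x. f x + g x)"
proof (rule square_summableI)
  fix F :: "'a set" assume "finite F"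
  then show "L2_set (\<lambda>x. norm (f x + g x)) F
      \<le> sqrt (\<Sum>\<^sub>\<infinity>x. (norm (f x))\<^sup>2) + sqrt (\<Sum>\<^sub>\<infinity>x. (norm (g x))\<^sup>2)"
    by (intro order_trans[OF L2_set_norm_add_le] add_mono L2_set_le_ell2_norm assms)
qed

lemma square_summable_uminus: "square_summable f \<Longrightarrow> square_summable (\<lambda>x. - f x)"
  by (simp add: square_summable_def)

lemma square_summable_scaleC:
  "square_summable (f :: 'x \<Rightarrow> 'k::complex_inner) \<Longrightarrow> square_summable (\<lambda>x. a *\<^sub>C f x)"
  by (simp add: square_summable_def power_mult_distrib summable_on_cmult_right)

lemma cinner_abs_summable:
  fixes f g :: "'x \<Rightarrow> 'k::complex_inner"
  assumes "square_summable f" "square_summable g"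
  shows "(\<lambda>x. norm (cinner (f x) (g x))) summable_on UNIV"
proof (rule summable_on_comparison_test)
  show "(\<lambda>x. (norm (f x))\<^sup>2 + (norm (g x))\<^sup>2) summable_on UNIV"
    using assms unfolding square_summable_def by (rule summable_on_add)
  show "norm (cinner (f x) (g x)) \<le> (norm (f x))\<^sup>2 + (norm (g x))\<^sup>2" for x
    using norm_cinner_le[of "f x" "g x"] sum_squares_bound[of "norm (f x)" "norm (g x)"]
      zero_le_power2[of "norm (f x)"] zero_le_power2[of "norm (g x)"]
    by linarith
qed simp

typedef (overloaded) ('x, 'k::complex_inner) ell2 = "{f :: 'x \<Rightarrow> 'k. square_summable f}"
  using square_summable_zero by blast

setup_lifting type_definition_ell2

lemma square_summable_Rep [simp]: "square_summable (Rep_ell2 f)"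
  using Rep_ell2[of f] by simp

instantiation ell2 :: (type, complex_inner) complex_inner
begin

lift_definition zero_ell2 :: "('a, 'b) ell2" is "\<lambda>_. 0" by (rule square_summable_zero)
lift_definition plus_ell2 :: "('a, 'b) ell2 \<Rightarrow> ('a, 'b) ell2 \<Rightarrow> ('a, 'b) ell2" is "\<lambda>f g x. f x + g x"
  by (rule square_summable_add)
lift_definition uminus_ell2 :: "('a, 'b) ell2 \<Rightarrow> ('a, 'b) ell2" is "\<lambda>f x. - f x"
  by (rule square_summable_uminus)
lift_definition minus_ell2 :: "('a, 'b) ell2 \<Rightarrow> ('a, 'b) ell2 \<Rightarrow> ('a, 'b) ell2" is "\<lambda>f g x. f x - g x"
  using square_summable_add[OF _ square_summable_uminus] by force
lift_definition scaleC_ell2 :: "complex \<Rightarrow> ('a, 'b) ell2 \<Rightarrow> ('a, 'b) ell2" is "\<lambda>a f x. a *\<^sub>C f x"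
  by (rule square_summable_scaleC)
lift_definition scaleR_ell2 :: "real \<Rightarrow> ('a, 'b) ell2 \<Rightarrow> ('a, 'b) ell2" is "\<lambda>a f x. a *\<^sub>R f x"
  by (simp add: square_summable_scaleC flip: scaleC_of_real)
lift_definition cinner_ell2 :: "('a, 'b) ell2 \<Rightarrow> ('a, 'b) ell2 \<Rightarrow> complex" is
  "\<lambda>f g. \<Sum>\<^sub>\<infinity>x. cinner (f x) (g x)" .
lift_definition norm_ell2 :: "('a, 'b) ell2 \<Rightarrow> real" is "\<lambda>f. sqrt (\<Sum>\<^sub>\<infinity>x. (norm (f x))\<^sup>2)" .
definition "sgn_ell2 (f :: ('a, 'b) ell2) = inverse (norm f) *\<^sub>R f"
definition "dist_ell2 (f :: ('a, 'b) ell2) g = norm (f - g)"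
definition [code del]:
  "uniformity_ell2 = (INF e\<in>{0<..}. principal {(f :: ('a, 'b) ell2, g). dist f g < e})"
definition [code del]:
  "open_ell2 U = (\<forall>f\<in>U. eventually (\<lambda>(f', g :: ('a, 'b) ell2). f' = f \<longrightarrow> g \<in> U) uniformity)"

instance
proof
  fix f g h :: "('a, 'b) ell2" and a b :: complex and r s :: real and U :: "('a, 'b) ell2 set"
  show "f + g + h = f + (g + h)" "f + g = g + f" "0 + f = f" "- f + f = 0" "f - g = f + - g"
    by (transfer; force simp: algebra_simps)+
  show "r *\<^sub>R (f + g) = r *\<^sub>R f + r *\<^sub>R g" "(r + s) *\<^sub>R f = r *\<^sub>R f + s *\<^sub>R f"
    "r *\<^sub>R s *\<^sub>R f = (r * s) *\<^sub>R f" "1 *\<^sub>R f = f"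
    by (transfer; simp add: scaleR_add_right scaleR_add_left)+
  show "a *\<^sub>C (f + g) = a *\<^sub>C f + a *\<^sub>C g" "(a + b) *\<^sub>C f = a *\<^sub>C f + b *\<^sub>C f"
    "a *\<^sub>C b *\<^sub>C f = (a * b) *\<^sub>C f" "complex_of_real r *\<^sub>C f = r *\<^sub>R f"
    by (transfer; simp add: scaleC_add_right scaleC_add_left scaleC_of_real)+
  show "dist f g = norm (f - g)" "sgn f = inverse (norm f) *\<^sub>R f"
    "uniformity = (INF e\<in>{0<..}. principal {(f :: ('a, 'b) ell2, g). dist f g < e})"
    "open U = (\<forall>f\<in>U. \<forall>\<^sub>F (f', g) in uniformity. f' = f \<longrightarrow> g \<in> U)"
    by (simp_all add: dist_ell2_def sgn_ell2_def uniformity_ell2_def open_ell2_def)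
  show "norm (f + g) \<le> norm f + norm g"
    by (transfer, rule ell2_norm_leI, rule order_trans[OF L2_set_norm_add_le])
       (intro add_mono L2_set_le_ell2_norm)
  show "norm f = 0 \<longleftrightarrow> f = 0"
  proof transfer
    fix f :: "'a \<Rightarrow> 'b" assume f: "square_summable f"
    have "f x = 0" if "sqrt (\<Sum>\<^sub>\<infinity>x. (norm (f x))\<^sup>2) = 0" for x
      using L2_set_le_ell2_norm[OF f, of "{x}"] that by (simp add: L2_set_def)
    then show "sqrt (\<Sum>\<^sub>\<infinity>x. (norm (f x))\<^sup>2) = 0 \<longleftrightarrow> f = (\<lambda>_. 0)" by auto
  qed
  show "norm (r *\<^sub>R f) = \<bar>r\<bar> * norm f"
    by transfer (simp add: power_mult_distrib infsum_cmult_right' real_sqrt_mult)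
  show "cinner f g = cnj (cinner g f)"
    by transfer (simp add: infsum_cnj[symmetric] cinner_commute[symmetric])
  show "cinner f (g + h) = cinner f g + cinner f h"
    by transfer
       (simp add: cinner_add_right infsum_add abs_summable_summable cinner_abs_summable)
  show "cinner f (a *\<^sub>C g) = a * cinner f g"
    by transfer (simp add: cinner_scaleC_right infsum_cmult_right')
  show "cinner f f = complex_of_real ((norm f)\<^sup>2)"
  proof transfer
    fix f :: "'a \<Rightarrow> 'b" assume "square_summable f"
    then have "((\<lambda>x. (norm (f x))\<^sup>2) has_sum (\<Sum>\<^sub>\<infinity>x. (norm (f x))\<^sup>2)) UNIV"
      by (simp add: square_summable_def)
    from infsumI[OF has_sum_bounded_linear[OF bounded_linear_of_real this]]
    show "(\<Sum>\<^sub>\<infinity>x. cinner (f x) (f x)) = complex_of_real ((sqrt (\<Sum>\<^sub>\<infinity>x. (norm (f x))\<^sup>2))\<^sup>2)"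
      by (simp add: cinner_self infsum_nonneg del: of_real_power)
  qed
qed

end

lemma norm_Rep_ell2_le: "norm (Rep_ell2 f x) \<le> norm f"
  using L2_set_le_ell2_norm[of "Rep_ell2 f" "{x}"] by (simp add: norm_ell2.rep_eq)

lemma L2_set_Rep_ell2_le: "finite F \<Longrightarrow> L2_set (\<lambda>x. norm (Rep_ell2 f x)) F \<le> norm f"
  by (simp add: norm_ell2.rep_eq L2_set_le_ell2_norm)

lemma norm_ell2_leI:
  "(\<And>F. finite F \<Longrightarrow> L2_set (\<lambda>x. norm (Rep_ell2 f x)) F \<le> B) \<Longrightarrow> norm f \<le> B"
  by (simp add: norm_ell2.rep_eq ell2_norm_leI)

instance ell2 :: (type, chilbert_space) chilbert_space
proof
  fix X :: "nat \<Rightarrow> ('a, 'b) ell2"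
  assume X: "Cauchy X"
  have "Cauchy (\<lambda>n. Rep_ell2 (X n) x)" for x
  proof (rule CauchyI)
    fix e :: real assume "e > 0"
    then obtain N where "\<forall>m\<ge>N. \<forall>n\<ge>N. norm (X m - X n) < e" using CauchyD[OF X] by blast
    then show "\<exists>N. \<forall>m\<ge>N. \<forall>n\<ge>N. norm (Rep_ell2 (X m) x - Rep_ell2 (X n) x) < e"
      by (metis minus_ell2.rep_eq norm_Rep_ell2_le order_le_less_trans)
  qed
  then have "\<exists>l. (\<lambda>n. Rep_ell2 (X n) x) \<longlonglongrightarrow> l" for x
    by (simp add: Cauchy_convergent_iff convergent_def)
  then obtain g where g: "\<And>x. (\<lambda>n. Rep_ell2 (X n) x) \<longlonglongrightarrow> g x" by metis
  have key: "\<exists>N. \<forall>n\<ge>N. \<forall>F. finite F \<longrightarrow> L2_set (\<lambda>x. norm (g x - Rep_ell2 (X n) x)) F \<le> e"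
    if e: "e > 0" for e
  proof -
    obtain N where N: "\<forall>m\<ge>N. \<forall>n\<ge>N. norm (X m - X n) < e" using CauchyD[OF X e] by blast
    have "L2_set (\<lambda>x. norm (g x - Rep_ell2 (X n) x)) F \<le> e" if "n \<ge> N" "finite F" for n F
    proof (rule LIMSEQ_le_const2)
      show "(\<lambda>m. L2_set (\<lambda>x. norm (Rep_ell2 (X m) x - Rep_ell2 (X n) x)) F)
          \<longlonglongrightarrow> L2_set (\<lambda>x. norm (g x - Rep_ell2 (X n) x)) F"
        unfolding L2_set_def by (intro tendsto_intros g)
      have "L2_set (\<lambda>x. norm (Rep_ell2 (X m) x - Rep_ell2 (X n) x)) F \<le> e" if "m \<ge> N" for m
        using L2_set_Rep_ell2_le[OF \<open>finite F\<close>, of "X m - X n"] N that \<open>n \<ge> N\<close>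
        by (fastforce simp: minus_ell2.rep_eq)
      then show "\<exists>N. \<forall>m\<ge>N. L2_set (\<lambda>x. norm (Rep_ell2 (X m) x - Rep_ell2 (X n) x)) F \<le> e" by blast
    qed
    then show ?thesis by blast
  qed
  have "square_summable g"
  proof -
    obtain N where N: "\<And>F. finite F \<Longrightarrow> L2_set (\<lambda>x. norm (g x - Rep_ell2 (X N) x)) F \<le> 1"
      using key[of 1] by auto
    have "square_summable (\<lambda>x. (g x - Rep_ell2 (X N) x) + Rep_ell2 (X N) x)"
      by (intro square_summable_add square_summableI[OF N]) auto
    then show ?thesis by simp
  qed
  then have Rg: "Rep_ell2 (Abs_ell2 g) = g" by (simp add: Abs_ell2_inverse)
  have "X \<longlonglongrightarrow> Abs_ell2 g"
  proof (rule LIMSEQ_I)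
    fix e :: real assume "e > 0"
    then obtain N where N: "\<And>n F. n \<ge> N \<Longrightarrow> finite F \<Longrightarrow>
        L2_set (\<lambda>x. norm (g x - Rep_ell2 (X n) x)) F \<le> e / 2"
      using key[of "e / 2"] by auto
    have "norm (X n - Abs_ell2 g) \<le> e / 2" if "n \<ge> N" for n
      using N[OF that] by (intro norm_ell2_leI) (simp add: minus_ell2.rep_eq Rg norm_minus_commute)
    then show "\<exists>N. \<forall>n\<ge>N. norm (X n - Abs_ell2 g) < e" using \<open>e > 0\<close>
      by (smt (verit) field_sum_of_halves)
  qed
  then show "convergent X" by (auto simp: convergent_def)
qed


lift_definition single_ell2 :: "'x \<Rightarrow> 'k::complex_inner \<Rightarrow> ('x, 'k) ell2" is
  "\<lambda>y k x. if x = y then k else 0"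
proof -
  fix y :: 'x and k :: 'k
  have "(\<lambda>x. (norm (if x = y then k else 0))\<^sup>2) summable_on {y}" by simp
  then show "square_summable (\<lambda>x. if x = y then k else 0)" unfolding square_summable_def
    by (subst summable_on_cong_neutral[where T = "{y}"]) auto
qed

lemma Rep_ell2_sum: "Rep_ell2 (sum f A) x = (\<Sum>i\<in>A. Rep_ell2 (f i) x)"
  by (induction A rule: infinite_finite_induct) (simp_all add: zero_ell2.rep_eq plus_ell2.rep_eq)

lemma Rep_sum_single:
  "finite F \<Longrightarrow> Rep_ell2 (\<Sum>y\<in>F. single_ell2 y (g y)) x = (if x \<in> F then g x else 0)"
  by (simp add: Rep_ell2_sum single_ell2.rep_eq)

lemma norm_sum_single_le:
  assumes F: "finite F"
  shows "norm (\<Sum>y\<in>F. single_ell2 y (g y)) \<le> L2_set (\<lambda>y. norm (g y)) F"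
proof (rule norm_ell2_leI)
  fix G :: "'a set" assume G: "finite G"
  have "(\<Sum>x\<in>G. (norm (if x \<in> F then g x else 0))\<^sup>2) = (\<Sum>x\<in>G \<inter> F. (norm (g x))\<^sup>2)"
    using G by (auto simp: sum.inter_restrict intro!: sum.cong)
  also have "\<dots> \<le> (\<Sum>x\<in>F. (norm (g x))\<^sup>2)"
    using F by (intro sum_mono2) auto
  finally show "L2_set (\<lambda>x. norm (Rep_ell2 (\<Sum>y\<in>F. single_ell2 y (g y)) x)) G \<le> L2_set (\<lambda>y. norm (g y)) F"
    by (simp add: L2_set_def Rep_sum_single[OF F])
qed

lemma has_sum_single_ell2: "((\<lambda>y. single_ell2 y (Rep_ell2 f y)) has_sum f) UNIV"
proof -
  let ?n = "\<lambda>x. (norm (Rep_ell2 f x))\<^sup>2"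
  have sm: "?n summable_on UNIV"
    using square_summable_Rep[of f] by (simp add: square_summable_def)
  have bound: "norm ((\<Sum>y\<in>F. single_ell2 y (Rep_ell2 f y)) - f) \<le> sqrt (infsum ?n UNIV - sum ?n F)"
    if F: "finite F" for F
  proof (rule norm_ell2_leI)
    fix G :: "'a set" assume G: "finite G"
    have "(\<Sum>x\<in>G. (norm ((if x \<in> F then Rep_ell2 f x else 0) - Rep_ell2 f x))\<^sup>2) = sum ?n (G - F)"
      using G by (intro sum.mono_neutral_cong_right) auto
    also have "\<dots> = sum ?n (G \<union> F) - sum ?n F"
      using F G by (metis Diff_cancel Un_Diff Un_upper2 finite_UnI sum_diff sup_bot.right_neutral)
    also have "\<dots> \<le> infsum ?n UNIV - sum ?n F"
      using finite_sum_le_infsum[OF sm, of "G \<union> F"] F G by simp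
    finally show "L2_set (\<lambda>x. norm (Rep_ell2 ((\<Sum>y\<in>F. single_ell2 y (Rep_ell2 f y)) - f) x)) G
        \<le> sqrt (infsum ?n UNIV - sum ?n F)"
      by (simp add: L2_set_def minus_ell2.rep_eq Rep_sum_single[OF F])
  qed
  have "((\<lambda>F. sqrt (infsum ?n UNIV - sum ?n F)) \<longlongrightarrow> sqrt (infsum ?n UNIV - infsum ?n UNIV))
      (finite_subsets_at_top UNIV)"
    using has_sum_infsum[OF sm] unfolding has_sum_def by (intro tendsto_intros)
  then have lim: "((\<lambda>F. sqrt (infsum ?n UNIV - sum ?n F)) \<longlongrightarrow> 0) (finite_subsets_at_top UNIV)"
    by simp
  have "\<forall>\<^sub>F F in finite_subsets_at_top UNIV. norm ((\<Sum>y\<in>F. single_ell2 y (Rep_ell2 f y)) - f)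
      \<le> sqrt (infsum ?n UNIV - sum ?n F)"
    by (rule eventually_finite_subsets_at_top_weakI) (rule bound)
  from Lim_null_comparison[OF this lim] show ?thesis
    unfolding has_sum_def by (simp add: Lim_null[symmetric])
qed


section \<open>The operators on l^2(X, K)\<close>

text \<open>The elementary tensor \<open>\<phi> \<otimes> k\<close> under the identification of \<open>l^2(X, K)\<close> with
  \<open>l^2(X) \<otimes> K\<close>.\<close>

lift_definition elem_tensor :: "('x, complex) ell2 \<Rightarrow> 'k::complex_inner \<Rightarrow> ('x, 'k) ell2" is
  "\<lambda>\<phi> k x. \<phi> x *\<^sub>C k"
  by (simp add: square_summable_def power_mult_distrib summable_on_cmult_left)

text \<open>\<open>H0 \<otimes> I\<close>; see \<open>tensor_id_ex1\<close> for existence and uniqueness.\<close>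

definition tensor_id ::
  "(('x, complex) ell2 \<Rightarrow> ('x, complex) ell2) \<Rightarrow> ('x, 'k::chilbert_space) ell2 \<Rightarrow> ('x, 'k) ell2" where
  "tensor_id H0 = (THE T. bounded_clinear T \<and>
     (\<forall>\<phi> k. T (elem_tensor \<phi> k) = elem_tensor (H0 \<phi>) k))"

text \<open>\<open>Abs_ell2\<close> is applied to square summable functions only if \<open>V\<close> is bounded (\<open>Rep_mult_op\<close>),
  respectively if \<open>\<phi>\<close> is a group action by permutations (\<open>Rep_translation\<close>).\<close>

definition mult_op :: "('x \<Rightarrow> 'k::complex_inner \<Rightarrow>\<^sub>L 'k) \<Rightarrow> ('x, 'k) ell2 \<Rightarrow> ('x, 'k) ell2" where
  "mult_op V f = Abs_ell2 (\<lambda>x. blinfun_apply (V x) (Rep_ell2 f x))"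

definition translation ::
  "('g, 'm) monoid_scheme \<Rightarrow> ('g \<Rightarrow> 'x \<Rightarrow> 'x) \<Rightarrow> 'g \<Rightarrow> ('x, 'k::complex_inner) ell2 \<Rightarrow> ('x, 'k) ell2" where
  "translation G \<phi> \<gamma> f = Abs_ell2 (\<lambda>x. Rep_ell2 f (\<phi> (inv\<^bsub>G\<^esub> \<gamma>) x))"

definition pseudo_ergodic ::
  "('g, 'm) monoid_scheme \<Rightarrow> ('g \<Rightarrow> 'x \<Rightarrow> 'x) \<Rightarrow> ('k::complex_inner \<Rightarrow>\<^sub>L 'k) set \<Rightarrow>
    ('x \<Rightarrow> 'k \<Rightarrow>\<^sub>L 'k) \<Rightarrow> bool" where
  "pseudo_ergodic G \<phi> M V \<longleftrightarrow> (\<forall>x. V x \<in> M) \<and>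
     (\<forall>\<epsilon>>0. \<forall>F W. finite F \<longrightarrow> (\<forall>x\<in>F. W x \<in> M) \<longrightarrow>
       (\<exists>\<gamma>\<in>carrier G. \<forall>x\<in>F. norm (W x - V (\<phi> \<gamma> x)) < \<epsilon>))"


subsection \<open>Well-definedness\<close>

lemma Rep_mult_op:
  assumes "bounded (range V)"
  shows "Rep_ell2 (mult_op V f) x = blinfun_apply (V x) (Rep_ell2 f x)"
proof -
  obtain B where B: "\<And>x. norm (V x) \<le> B" using assms by (auto simp: bounded_iff)
  have "L2_set (\<lambda>x. norm (blinfun_apply (V x) (Rep_ell2 f x))) F \<le> B * norm f" if "finite F" for F
  proof -
    have "0 \<le> B" using B[of undefined] norm_ge_zero order_trans by blast
    have "norm (blinfun_apply (V x) (Rep_ell2 f x)) \<le> B * norm (Rep_ell2 f x)" for x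
      by (rule order_trans[OF norm_blinfun mult_right_mono[OF B]]) simp
    then have "L2_set (\<lambda>x. norm (blinfun_apply (V x) (Rep_ell2 f x))) F
        \<le> L2_set (\<lambda>x. B * norm (Rep_ell2 f x)) F" by (intro L2_set_mono) auto
    also have "\<dots> \<le> B * norm f"
      using mult_left_mono[OF L2_set_Rep_ell2_le[OF that] \<open>0 \<le> B\<close>] \<open>0 \<le> B\<close>
      by (simp add: L2_set_right_distrib)
    finally show ?thesis .
  qed
  from square_summableI[OF this] show ?thesis by (simp add: mult_op_def Abs_ell2_inverse)
qed

lemma Rep_translation:
  assumes "group_action G (UNIV :: 'x set) \<phi>" "\<gamma> \<in> carrier G"
  shows "Rep_ell2 (translation G \<phi> \<gamma> f) x = Rep_ell2 f (\<phi> (inv\<^bsub>G\<^esub> \<gamma>) x)"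
proof -
  interpret group_action G "UNIV :: 'x set" \<phi> by fact
  have "group G" using group_hom group_hom.axioms(1) by blast
  then have i: "inv\<^bsub>G\<^esub> \<gamma> \<in> carrier G" using assms(2) by (simp add: group.inv_closed)
  have "square_summable (\<lambda>x. Rep_ell2 f (\<phi> (inv\<^bsub>G\<^esub> \<gamma>) x))"
    using square_summable_Rep[of f]
      summable_on_reindex[OF inj_prop[OF i], of "\<lambda>x. (norm (Rep_ell2 f x))\<^sup>2"]
    by (simp add: square_summable_def surj_prop[OF i] comp_def)
  then show ?thesis by (simp add: translation_def Abs_ell2_inverse)
qed

lemma finite_orthonormal_expansion:
  fixes S :: "'a::complex_inner set"
  assumes "finite S"
  shows "\<exists>B. finite B \<and> (\<forall>b\<in>B. \<forall>c\<in>B. cinner b c = (if b = c then 1 else 0)) \<and>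
    (\<forall>v\<in>S. v = (\<Sum>b\<in>B. cinner b v *\<^sub>C b))"
  using assms
proof (induction S)
  case empty
  show ?case by (rule exI[of _ "{}"]) simp
next
  case (insert v S)
  then obtain B where B: "finite B" "\<forall>b\<in>B. \<forall>c\<in>B. cinner b c = (if b = c then 1 else 0)"
    "\<forall>v\<in>S. v = (\<Sum>b\<in>B. cinner b v *\<^sub>C b)" by blast
  define p where "p = (\<Sum>b\<in>B. cinner b v *\<^sub>C b)"
  define u where "u = v - p"
  have p: "cinner c p = cinner c v" if "c \<in> B" for c
  proof -
    have "cinner c p = (\<Sum>b\<in>B. cinner b v * cinner c b)"
      by (simp add: p_def cinner_sum_right cinner_scaleC_right)
    also have "\<dots> = (\<Sum>b\<in>B. if b = c then cinner b v else 0)"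
      using B(2) that by (intro sum.cong) auto
    finally show ?thesis using B(1) that by simp
  qed
  have bu: "cinner c u = 0" if "c \<in> B" for c
    using p[OF that] by (simp add: u_def cinner_diff_right)
  have ub: "cinner u c = 0" if "c \<in> B" for c
    using bu[OF that] cinner_commute[of u c] by simp
  show ?case
  proof (cases "u = 0")
    case True
    then have "x = (\<Sum>b\<in>B. cinner b x *\<^sub>C b)" if "x \<in> insert v S" for x
      using B(3) that by (metis eq_iff_diff_eq_0 insertE p_def u_def)
    then show ?thesis using B(1,2) by blast
  next
    case False
    define w where "w = complex_of_real (inverse (norm u)) *\<^sub>C u"
    have "norm w = 1" using False by (simp add: w_def norm_inverse)
    then have nw: "cinner w w = 1" by (simp add: cinner_self)
    have bw: "cinner c w = 0" "cinner w c = 0" if "c \<in> B" for c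
      using bu[OF that] ub[OF that] by (simp_all add: w_def cinner_scaleC_left cinner_scaleC_right)
    have "w \<notin> B" using nw bw by fastforce
    have wS: "cinner w s = 0" if "s \<in> S" for s
    proof -
      have "cinner w s = cinner w (\<Sum>b\<in>B. cinner b s *\<^sub>C b)"
        by (rule arg_cong[OF bspec[OF B(3) that]])
      also have "\<dots> = 0" by (simp add: cinner_sum_right cinner_scaleC_right bw)
      finally show ?thesis .
    qed
    have "cinner w v = cinner w u + cinner w p"
      by (simp add: u_def flip: cinner_add_right)
    also have "cinner w p = 0" by (simp add: p_def cinner_sum_right cinner_scaleC_right bw)
    also have "cinner w u = complex_of_real (norm u)"
      using False by (simp add: w_def cinner_scaleC_left cinner_self power2_eq_square)
    finally have "cinner w v *\<^sub>C w = u" using False by (simp add: w_def)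
    then have v: "v = (\<Sum>b\<in>insert w B. cinner b v *\<^sub>C b)"
      by (simp only: sum.insert[OF B(1) \<open>w \<notin> B\<close>]) (simp add: u_def p_def)
    have s: "s = (\<Sum>b\<in>insert w B. cinner b s *\<^sub>C b)" if "s \<in> S" for s
      by (simp only: sum.insert[OF B(1) \<open>w \<notin> B\<close>] wS[OF that] complex_vector.scale_zero_left add_0_left)
         (rule bspec[OF B(3) that])
    have "cinner b c = (if b = c then 1 else 0)" if "b \<in> insert w B" "c \<in> insert w B" for b c
      using B(2) nw bw \<open>w \<notin> B\<close> that by auto
    moreover have "x = (\<Sum>b\<in>insert w B. cinner b x *\<^sub>C b)" if "x \<in> insert v S" for x
      using that v s by blast
    ultimately show ?thesis using B(1)
      by (intro exI[of _ "insert w B"] conjI ballI) (blast intro: finite.insertI)+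
  qed
qed

lemma norm_orthonormal_sum:
  fixes B :: "'a::complex_inner set"
  assumes "finite B" "\<forall>b\<in>B. \<forall>c\<in>B. cinner b c = (if b = c then 1 else 0)"
  shows "(norm (\<Sum>b\<in>B. a b *\<^sub>C b))\<^sup>2 = (\<Sum>b\<in>B. (norm (a b))\<^sup>2)"
proof -
  have "complex_of_real ((norm (\<Sum>b\<in>B. a b *\<^sub>C b))\<^sup>2) = (\<Sum>b\<in>B. \<Sum>c\<in>B. a b * (cnj (a c) * cinner c b))"
    by (simp add: cinner_self[symmetric] cinner_sum_left cinner_sum_right cinner_scaleC_left
        cinner_scaleC_right sum_distrib_left del: of_real_power)
  also have "\<dots> = (\<Sum>b\<in>B. \<Sum>c\<in>B. if c = b then a b * cnj (a b) else 0)"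
    using assms(2) by (intro sum.cong) auto
  also have "\<dots> = (\<Sum>b\<in>B. complex_of_real ((norm (a b))\<^sup>2))"
    using assms(1) by (simp add: complex_norm_square del: of_real_power)
  also have "\<dots> = complex_of_real (\<Sum>b\<in>B. (norm (a b))\<^sup>2)" by simp
  finally show ?thesis using of_real_eq_iff by blast
qed

lemma bounded_linear_Rep_ell2: "bounded_linear (\<lambda>f. Rep_ell2 f x)"
  by (rule bounded_linear_intro[where K = 1])
     (simp_all add: plus_ell2.rep_eq scaleR_ell2.rep_eq norm_Rep_ell2_le)

lemma bounded_linear_scaleC_left: "bounded_linear (\<lambda>a. a *\<^sub>C (k::'k::complex_inner))"
  by (rule bounded_linear_intro[where K = "norm k"])
     (simp_all add: scaleC_add_left scaleC_of_real[symmetric] scaleC_complex_def)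

lemma bounded_linear_scaleC_right: "bounded_linear (\<lambda>k::'k::complex_inner. a *\<^sub>C k)"
  by (rule bounded_linear_intro[where K = "norm a"])
     (simp_all add: scaleC_add_right scaleC_of_real[symmetric] mult.commute)

lemma tensor_id_ex1:
  fixes H0 :: "('x, complex) ell2 \<Rightarrow> ('x, complex) ell2"
  assumes "bounded_clinear H0"
  shows "\<exists>!T :: ('x, 'k::chilbert_space) ell2 \<Rightarrow> ('x, 'k) ell2.
    bounded_clinear T \<and> (\<forall>\<phi> k. T (elem_tensor \<phi> k) = elem_tensor (H0 \<phi>) k)"
proof (rule ex_ex1I)
  interpret H0: bounded_linear H0 using assms by (simp add: bounded_clinear_def)
  have H0C: "H0 (c *\<^sub>C \<phi>) = c *\<^sub>C H0 \<phi>" for c \<phi> using assms by (simp add: bounded_clinear_def)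
  obtain C where "C > 0" and C: "\<And>\<phi>. norm (H0 \<phi>) \<le> C * norm \<phi>"
    using H0.pos_bounded by (metis mult.commute)
  define h where "h x y = Rep_ell2 (H0 (single_ell2 y 1)) x" for x y
  have single: "single_ell2 y c = c *\<^sub>C single_ell2 y (1::complex)" for y :: 'x and c
    by transfer (auto simp: scaleC_complex_def)
  have h: "Rep_ell2 (H0 (single_ell2 y c)) x = c * h x y" for x y c
    by (simp add: single[of y c] H0C scaleC_ell2.rep_eq scaleC_complex_def h_def)
  have h_sum: "Rep_ell2 (H0 (\<Sum>y\<in>F. single_ell2 y (g y))) x = (\<Sum>y\<in>F. g y * h x y)" for F g x
    by (simp add: H0.sum Rep_ell2_sum h)

  have row: "square_summable (h x)" for x
  proof (rule square_summableI)
    fix F :: "'x set" assume F: "finite F"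
    let ?l = "L2_set (\<lambda>y. norm (h x y)) F"
    have "complex_of_real (?l\<^sup>2) = (\<Sum>y\<in>F. cnj (h x y) * h x y)"
      by (simp add: L2_set_def sum_nonneg complex_norm_square mult.commute del: of_real_power)
    also have "\<dots> = Rep_ell2 (H0 (\<Sum>y\<in>F. single_ell2 y (cnj (h x y)))) x" by (simp add: h_sum)
    finally have eq: "complex_of_real (?l\<^sup>2) = Rep_ell2 (H0 (\<Sum>y\<in>F. single_ell2 y (cnj (h x y)))) x" .
    have "?l\<^sup>2 = norm (Rep_ell2 (H0 (\<Sum>y\<in>F. single_ell2 y (cnj (h x y)))) x)"
      unfolding eq[symmetric] norm_of_real abs_power2 ..
    also have "\<dots> \<le> C * norm (\<Sum>y\<in>F. single_ell2 y (cnj (h x y)))"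
      by (rule order_trans[OF norm_Rep_ell2_le C])
    also have "\<dots> \<le> C * ?l"
      using norm_sum_single_le[OF F, of "\<lambda>y. cnj (h x y)"] \<open>C > 0\<close> by simp
    finally have le: "?l * ?l \<le> C * ?l" by (simp add: power2_eq_square)
    show "?l \<le> C"
    proof (cases "?l = 0")
      case False
      then have "?l > 0" using L2_set_nonneg[of "\<lambda>y. norm (h x y)" F] by linarith
      then show ?thesis using le by simp
    qed (use \<open>C > 0\<close> in simp)
  qed

  have bound: "L2_set (\<lambda>x. norm (\<Sum>y\<in>F. h x y *\<^sub>C f y)) G \<le> C * L2_set (\<lambda>y. norm (f y)) F"
    if F: "finite F" and G: "finite G" for F G and f :: "'x \<Rightarrow> 'k"
  proof -
    obtain B where B: "finite B" "\<forall>b\<in>B. \<forall>c\<in>B. cinner b c = (if b = c then 1 else 0)"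
      "\<forall>v\<in>f ` F. v = (\<Sum>b\<in>B. cinner b v *\<^sub>C b)"
      using finite_orthonormal_expansion[of "f ` F"] F by blast
    define c where "c b y = cinner b (f y)" for b y
    have f: "f y = (\<Sum>b\<in>B. c b y *\<^sub>C b)" if "y \<in> F" for y using B(3) that by (simp add: c_def)
    define \<phi> where "\<phi> b = (\<Sum>y\<in>F. single_ell2 y (c b y))" for b
    have "(\<Sum>y\<in>F. h x y *\<^sub>C f y) = (\<Sum>b\<in>B. Rep_ell2 (H0 (\<phi> b)) x *\<^sub>C b)" for x
    proof -
      have "(\<Sum>y\<in>F. h x y *\<^sub>C f y) = (\<Sum>y\<in>F. \<Sum>b\<in>B. (c b y * h x y) *\<^sub>C b)"
        by (intro sum.cong refl) (simp add: f complex_vector.scale_sum_right mult.commute)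
      also have "\<dots> = (\<Sum>b\<in>B. \<Sum>y\<in>F. (c b y * h x y) *\<^sub>C b)" by (rule sum.swap)
      also have "\<dots> = (\<Sum>b\<in>B. Rep_ell2 (H0 (\<phi> b)) x *\<^sub>C b)"
        by (simp add: \<phi>_def h_sum complex_vector.scale_sum_left)
      finally show ?thesis .
    qed
    then have "(\<Sum>x\<in>G. (norm (\<Sum>y\<in>F. h x y *\<^sub>C f y))\<^sup>2)
        = (\<Sum>x\<in>G. \<Sum>b\<in>B. (norm (Rep_ell2 (H0 (\<phi> b)) x))\<^sup>2)"
      by (simp add: norm_orthonormal_sum[OF B(1,2)])
    also have "\<dots> = (\<Sum>b\<in>B. (L2_set (\<lambda>x. norm (Rep_ell2 (H0 (\<phi> b)) x)) G)\<^sup>2)"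
      by (subst sum.swap) (simp add: L2_set_def sum_nonneg)
    also have "\<dots> \<le> (\<Sum>b\<in>B. (C * L2_set (\<lambda>y. norm (c b y)) F)\<^sup>2)"
    proof (intro sum_mono power_mono)
      fix b
      have "L2_set (\<lambda>x. norm (Rep_ell2 (H0 (\<phi> b)) x)) G \<le> C * norm (\<phi> b)"
        by (rule order_trans[OF L2_set_Rep_ell2_le[OF G] C])
      also have "\<dots> \<le> C * L2_set (\<lambda>y. norm (c b y)) F"
        using \<open>C > 0\<close> norm_sum_single_le[OF F] by (simp add: \<phi>_def)
      finally show "L2_set (\<lambda>x. norm (Rep_ell2 (H0 (\<phi> b)) x)) G \<le> C * L2_set (\<lambda>y. norm (c b y)) F" .
    qed simp
    also have "\<dots> = C\<^sup>2 * (\<Sum>b\<in>B. \<Sum>y\<in>F. (norm (c b y))\<^sup>2)"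
      by (simp add: power_mult_distrib L2_set_def sum_nonneg sum_distrib_left)
    also have "\<dots> = C\<^sup>2 * (\<Sum>y\<in>F. \<Sum>b\<in>B. (norm (c b y))\<^sup>2)"
      by (subst sum.swap) simp
    also have "(\<Sum>y\<in>F. \<Sum>b\<in>B. (norm (c b y))\<^sup>2) = (\<Sum>y\<in>F. (norm (f y))\<^sup>2)"
      by (intro sum.cong refl) (simp add: f norm_orthonormal_sum[OF B(1,2)])
    finally have "sqrt (\<Sum>x\<in>G. (norm (\<Sum>y\<in>F. h x y *\<^sub>C f y))\<^sup>2) \<le> sqrt (C\<^sup>2 * (\<Sum>y\<in>F. (norm (f y))\<^sup>2))"
      by (rule real_sqrt_le_mono)
    then show ?thesis using \<open>C > 0\<close> by (simp add: L2_set_def real_sqrt_mult)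
  qed

  define t :: "('x, 'k) ell2 \<Rightarrow> 'x \<Rightarrow> 'k" where "t f x = (\<Sum>\<^sub>\<infinity>y. h x y *\<^sub>C Rep_ell2 f y)" for f x
  have summ: "(\<lambda>y. h x y *\<^sub>C Rep_ell2 f y) summable_on UNIV" for x and f :: "('x, 'k) ell2"
  proof (rule abs_summable_summable, rule summable_on_comparison_test)
    show "(\<lambda>y. (norm (h x y))\<^sup>2 + (norm (Rep_ell2 f y))\<^sup>2) summable_on UNIV"
      using row[of x] square_summable_Rep[of f] unfolding square_summable_def by (rule summable_on_add)
    show "norm (h x y *\<^sub>C Rep_ell2 f y) \<le> (norm (h x y))\<^sup>2 + (norm (Rep_ell2 f y))\<^sup>2" for y
      using sum_squares_bound[of "norm (h x y)" "norm (Rep_ell2 f y)"]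
        mult_nonneg_nonneg[OF norm_ge_zero[of "h x y"] norm_ge_zero[of "Rep_ell2 f y"]]
      unfolding norm_scaleC by linarith
  qed simp
  have t_le: "L2_set (\<lambda>x. norm (t f x)) G \<le> C * norm f" if G: "finite G" for f G
  proof (rule tendsto_upperbound)
    show "((\<lambda>F. L2_set (\<lambda>x. norm (\<Sum>y\<in>F. h x y *\<^sub>C Rep_ell2 f y)) G) \<longlongrightarrow> L2_set (\<lambda>x. norm (t f x)) G)
        (finite_subsets_at_top UNIV)"
      unfolding L2_set_def t_def using has_sum_infsum[OF summ, unfolded has_sum_def]
      by (intro tendsto_intros)
    have "L2_set (\<lambda>x. norm (\<Sum>y\<in>F. h x y *\<^sub>C Rep_ell2 f y)) G \<le> C * norm f" if "finite F" for F
      using bound[OF that G, of "Rep_ell2 f"] mult_left_mono[OF L2_set_Rep_ell2_le[OF that, of f], of C] \<open>C > 0\<close>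
      by linarith
    then show "\<forall>\<^sub>F F in finite_subsets_at_top UNIV.
        L2_set (\<lambda>x. norm (\<Sum>y\<in>F. h x y *\<^sub>C Rep_ell2 f y)) G \<le> C * norm f"
      by (intro eventually_finite_subsets_at_top_weakI)
  qed simp
  define T where "T f = Abs_ell2 (t f)" for f
  have RT: "Rep_ell2 (T f) = t f" for f
    by (simp add: T_def Abs_ell2_inverse square_summableI[OF t_le])
  have TC: "T (c *\<^sub>C f) = c *\<^sub>C T f" for c f
  proof -
    have "t (c *\<^sub>C f) x = c *\<^sub>C t f x" for x
      using infsumI[OF has_sum_bounded_linear[OF bounded_linear_scaleC_right[of c] has_sum_infsum[OF summ[of x f]]]]
      by (simp add: t_def scaleC_ell2.rep_eq mult.commute)
    then show ?thesis by (intro Rep_ell2_inject[THEN iffD1] ext) (simp add: RT scaleC_ell2.rep_eq)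
  qed
  have "bounded_linear T"
  proof (rule bounded_linear_intro[where K = C])
    show "T (f + g) = T f + T g" for f g
      by (intro Rep_ell2_inject[THEN iffD1] ext)
         (simp add: RT plus_ell2.rep_eq t_def scaleC_add_right infsum_add summ)
    show "T (r *\<^sub>R f) = r *\<^sub>R T f" for r f
      using TC[of "complex_of_real r"] by (simp add: scaleC_of_real)
    show "norm (T f) \<le> norm f * C" for f
      using norm_ell2_leI[of "T f" "C * norm f"] t_le[of _ f] by (simp add: RT mult.commute)
  qed
  moreover have "T (elem_tensor \<phi> k) = elem_tensor (H0 \<phi>) k" for \<phi> k
  proof (intro Rep_ell2_inject[THEN iffD1] ext)
    fix x
    have "((\<lambda>y. Rep_ell2 (H0 (single_ell2 y (Rep_ell2 \<phi> y))) x) has_sum Rep_ell2 (H0 \<phi>) x) UNIV"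
      by (rule has_sum_bounded_linear[OF bounded_linear_Rep_ell2
            has_sum_bounded_linear[OF H0.bounded_linear_axioms has_sum_single_ell2]])
    from infsumI[OF has_sum_bounded_linear[OF bounded_linear_scaleC_left[of k] this]]
    show "Rep_ell2 (T (elem_tensor \<phi> k)) x = Rep_ell2 (elem_tensor (H0 \<phi>) k) x"
      by (simp add: RT t_def elem_tensor.rep_eq h mult.commute)
  qed
  ultimately show "\<exists>T :: ('x, 'k) ell2 \<Rightarrow> ('x, 'k) ell2.
      bounded_clinear T \<and> (\<forall>\<phi> k. T (elem_tensor \<phi> k) = elem_tensor (H0 \<phi>) k)"
    using TC by (auto simp: bounded_clinear_def)
next
  fix T S :: "('x, 'k) ell2 \<Rightarrow> ('x, 'k) ell2"
  assume *: "bounded_clinear T \<and> (\<forall>\<phi> k. T (elem_tensor \<phi> k) = elem_tensor (H0 \<phi>) k)"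
    "bounded_clinear S \<and> (\<forall>\<phi> k. S (elem_tensor \<phi> k) = elem_tensor (H0 \<phi>) k)"
  then have T: "bounded_linear T" and S: "bounded_linear S"
    by (simp_all add: bounded_clinear_def)
  have "single_ell2 y k = elem_tensor (single_ell2 y 1) k" for y :: 'x and k :: 'k
    by transfer auto
  then have eq: "T (single_ell2 y k) = S (single_ell2 y k)" for y k using * by simp
  have "T f = S f" for f
  proof (rule has_sum_unique)
    show "((\<lambda>y. T (single_ell2 y (Rep_ell2 f y))) has_sum T f) UNIV"
      by (rule has_sum_bounded_linear[OF T has_sum_single_ell2])
    show "((\<lambda>y. T (single_ell2 y (Rep_ell2 f y))) has_sum S f) UNIV"
      unfolding eq by (rule has_sum_bounded_linear[OF S has_sum_single_ell2])
  qed
  then show "T = S" by (rule ext)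
qed

end

theory Submission
  imports Defs
begin

text \<open>
  Write \<open>A = H - z\<close> with \<open>z \<in> Spec(H)\<close> and suppose that \<open>A\<close> were Fredholm. A Fredholm operator
  that is not boundedly invertible fails to be injective or has a proper closed range. In the
  first case there is a unit vector \<open>f\<close> with \<open>A f = 0\<close>; in the second there are unit vectors \<open>g\<close>
  that are almost orthogonal to the range, \<open>|\<langle>g, A h\<rangle>| \<le> \<delta> \<parallel>h\<parallel>\<close> for all \<open>h\<close>, with \<open>\<delta>\<close> as small
  as desired (\<open>fredholm_spectrum_cases\<close>). Either way there is one approximate null vector of \<open>A\<close>
  or of its adjoint, and it may be taken to vanish outside a finite set \<open>F\<close>
  (\<open>finitely_supported_unit_approx\<close>).

  Pseudo-ergodicity turns one such vector into arbitrarily many orthonormal ones. Since \<open>\<M>\<close> has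
  two different points, there are group elements for which \<open>V\<close> is close to one of them on the
  first translate of \<open>F\<close> and close to the other on the second; hence these two translates are
  disjoint. Repeating this with larger finite sets gives any number of pairwise disjoint
  translates of \<open>F\<close>. The union of these is again a finite set, on which \<open>V|F\<close> may be prescribed
  on each translate, so that after one more translation the pattern \<open>V|F\<close> reappears, up to
  \<open>\<epsilon>\<close>, at all of them (\<open>recurrent_disjoint_translates\<close>). As \<open>H\<^sub>0\<close> commutes with translations,
  each translate of the approximate null vector is again one, with an error increased only by
  \<open>\<epsilon>\<close>, and disjointness of supports makes the translates orthonormal
  (\<open>orthonormal_recurrent_translates\<close>).

  On the other hand, a Fredholm operator admits only a bounded number of orthonormal approximate
  null vectors, both for the kernel and for the cokernel (\<open>fredholm_almost_kernel_card_le\<close>,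
  \<open>fredholm_almost_cokernel_card_le\<close>): by the open mapping theorem each of them has a component
  of definite size in a fixed finite-dimensional space, and by Bessel's inequality the squares of
  these components add up to at most the dimension. This is a contradiction.
\<close>

section \<open>The open mapping theorem\<close>

text \<open>By Baire's theorem in the complete space \<open>range A\<close>, the closure
  of the image of some ball contains a relative ball, so that every element of the range has an
  approximate preimage of controlled norm with error at most half of its norm. Applying this
  successively to the errors gives a geometric series whose sum is an exact preimage.\<close>

lemma closed_range_bounded_preimage:
  fixes A :: "'a::banach \<Rightarrow> 'b::banach"
  assumes A: "bounded_linear A" and cl: "closed (range A)"
  obtains C where "C > 0" "\<And>r. r \<in> range A \<Longrightarrow> \<exists>f. A f = r \<and> norm f \<le> C * norm r"
proof -
  interpret A: bounded_linear A by fact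
  let ?R = "range A"
  let ?K = "\<lambda>n. A ` cball 0 (real n)"
  have cK: "closure (?K n) \<subseteq> ?R" for n
    using cl by (intro closure_minimal) auto
  have "\<exists>n. top_of_set ?R interior_of closure (?K n) \<noteq> {}"
  proof (rule ccontr)
    assume "\<not> ?thesis"
    moreover have "closedin (top_of_set ?R) (closure (?K n))" for n
      using cK by (auto simp: closedin_closed_eq[OF cl])
    ultimately have "top_of_set ?R interior_of \<Union>(range (\<lambda>n. closure (?K n))) = {}"
      using cl by (intro Baire_category_alt disjI1 completely_metrizable_space_closedin
          [OF completely_metrizable_space_euclidean]) auto
    moreover have "\<Union>(range (\<lambda>n. closure (?K n))) = ?R"
    proof
      show "\<Union>(range (\<lambda>n. closure (?K n))) \<subseteq> ?R" using cK by blast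
      show "?R \<subseteq> \<Union>(range (\<lambda>n. closure (?K n)))"
      proof clarify
        fix x :: "'a"
        obtain n :: nat where "norm x \<le> real n" using real_arch_simple by blast
        then have "A x \<in> ?K n" by auto
        then show "A x \<in> \<Union>(range (\<lambda>n. closure (?K n)))"
          using closure_subset[of "?K n"] by (intro UN_I[of n]) auto
      qed
    qed
    ultimately show False
      using interior_of_topspace[of "top_of_set ?R"] by simp
  qed
  then obtain n y where "y \<in> top_of_set ?R interior_of closure (?K n)" by blast
  then obtain T where "openin (top_of_set ?R) T" "y \<in> T" "T \<subseteq> closure (?K n)"
    by (auto simp: interior_of_def)
  then obtain e where e: "e > 0" "ball y e \<inter> ?R \<subseteq> closure (?K n)" and y: "y \<in> ?R"
    unfolding openin_contains_ball by blast
  \<comment> \<open>Move the ball from \<open>y\<close> to the origin by subtracting approximate preimages.\<close>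
  have near: "\<exists>w. norm w \<le> 2 * real n \<and> norm (A w - z) < \<eta>"
    if z: "z \<in> ?R" "norm z < e" and "\<eta> > 0" for z \<eta>
  proof -
    have "y + z \<in> ?R" using y z(1) by (auto simp flip: A.add)
    then have "y + z \<in> ball y e \<inter> ?R" "y \<in> ball y e \<inter> ?R"
      using e(1) z(2) y by (simp_all add: dist_norm)
    then have "y + z \<in> closure (?K n)" "y \<in> closure (?K n)"
      using e(2) by blast+
    then obtain p q where p: "p \<in> ?K n" "dist p (y + z) < \<eta> / 2"
      and q: "q \<in> ?K n" "dist q y < \<eta> / 2"
      using \<open>\<eta> > 0\<close> unfolding closure_approachable by (meson half_gt_zero)
    then obtain u v where u: "norm u \<le> n" "dist (A u) (y + z) < \<eta> / 2"
      and v: "norm v \<le> n" "dist (A v) y < \<eta> / 2" by auto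
    have "norm (A (u - v) - z) = norm ((A u - (y + z)) - (A v - y))"
      by (simp add: A.diff algebra_simps)
    also have "\<dots> < \<eta>"
      using norm_triangle_ineq4[of "A u - (y + z)" "A v - y"] u v by (simp add: dist_norm)
    finally show ?thesis using norm_triangle_ineq4[of u v] u v
      by (intro exI[of _ "u - v"]) auto
  qed
  \<comment> \<open>The constant comes from scaling \<open>r\<close> to norm \<open>e / 2\<close>; the summand \<open>1\<close> keeps \<open>C\<close> positive when \<open>n = 0\<close>.\<close>
  define C where "C = 4 * real n / e + 1"
  have C: "C > 0" using e by (simp add: C_def add_nonneg_pos)
  have "\<exists>f. norm (A f - r) \<le> norm r / 2 \<and> norm f \<le> C * norm r" if r: "r \<in> ?R" for r
  proof (cases "r = 0")
    case True
    then show ?thesis by (intro exI[of _ 0]) (simp add: A.zero)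
  next
    case False
    define t where "t = e / (2 * norm r)"
    have t: "t > 0" using e False by (simp add: t_def)
    have "t *\<^sub>R r \<in> ?R" using r by (auto simp flip: A.scaleR)
    moreover have nt: "norm (t *\<^sub>R r) = e / 2" using e False by (simp add: t_def)
    ultimately obtain w where w: "norm w \<le> 2 * real n" "norm (A w - t *\<^sub>R r) < e / 4"
      using near[of "t *\<^sub>R r" "e / 4"] e by auto
    have "norm (A ((1/t) *\<^sub>R w) - r) = norm ((1/t) *\<^sub>R (A w - t *\<^sub>R r))"
      using t by (simp add: A.scaleR scaleR_right_diff_distrib)
    also have "\<dots> = (1/t) * norm (A w - t *\<^sub>R r)" using t by (simp only: norm_scaleR) simp
    also have "\<dots> \<le> (1/t) * (e / 4)" using w t by (intro mult_left_mono) auto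
    also have "\<dots> = norm r / 2" using e False by (simp add: t_def)
    finally have 1: "norm (A ((1/t) *\<^sub>R w) - r) \<le> norm r / 2" .
    have "norm ((1/t) *\<^sub>R w) = (1/t) * norm w" using t by simp
    also have "\<dots> \<le> (1/t) * (2 * real n)" using w t by (intro mult_left_mono) auto
    also have "\<dots> = (C - 1) * norm r" using e False by (simp add: t_def C_def)
    also have "\<dots> \<le> C * norm r" by (simp add: mult_right_mono)
    finally show ?thesis using 1 by blast
  qed
  then obtain g where g: "\<And>r. r \<in> ?R \<Longrightarrow> norm (A (g r) - r) \<le> norm r / 2"
    "\<And>r. r \<in> ?R \<Longrightarrow> norm (g r) \<le> C * norm r" by metis
  have "\<exists>f. A f = r \<and> norm f \<le> (2 * C) * norm r" if r: "r \<in> ?R" for r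
  proof -
    \<comment> \<open>\<open>s k\<close> is the error left after \<open>k\<close> corrections.\<close>
    define s where "s k = ((\<lambda>r. r - A (g r)) ^^ k) r" for k
    have s0: "s 0 = r" and sS: "s (Suc k) = s k - A (g (s k))" for k
      by (simp_all add: s_def)
    have sR: "s k \<in> ?R" for k
    proof (induction k)
      case (Suc k)
      then show ?case by (auto simp: sS simp flip: A.diff)
    qed (simp add: s0 r)
    have ns: "norm (s k) \<le> norm r * (1/2) ^ k" for k
    proof (induction k)
      case (Suc k)
      then show ?case using g(1)[OF sR[of k]] by (simp add: sS norm_minus_commute)
    qed (simp add: s0)
    have bnd: "norm (g (s k)) \<le> C * norm r * (1/2) ^ k" for k
      using g(2)[OF sR[of k]] mult_left_mono[OF ns[of k], of C] C
      unfolding mult.assoc by linarith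
    have geo: "(\<lambda>k. C * norm r * (1/2) ^ k) sums (C * norm r * 2)"
      using sums_mult[OF geometric_sums[of "1/2::real"], of "C * norm r"] by simp
    have sn: "summable (\<lambda>k. norm (g (s k)))"
      by (rule summable_comparison_test'[OF sums_summable[OF geo]]) (simp add: bnd)
    then have sg: "(\<lambda>k. g (s k)) sums (\<Sum>k. g (s k))"
      using summable_norm_cancel by (metis summable_sums)
    have "(\<Sum>k<m. A (g (s k))) = r - s m" for m
      by (induction m) (simp_all add: s0 sS)
    then have "(\<lambda>m. r - s m) \<longlonglongrightarrow> A (\<Sum>k. g (s k))"
      using A.sums[OF sg] by (simp add: sums_def)
    moreover have "s \<longlonglongrightarrow> 0"
    proof (rule Lim_null_comparison)
      show "(\<lambda>k. norm r * (1/2) ^ k) \<longlonglongrightarrow> 0"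
        by (intro tendsto_mult_right_zero LIMSEQ_power_zero) simp
    qed (simp add: ns)
    then have "(\<lambda>m. r - s m) \<longlonglongrightarrow> r" using tendsto_diff[OF tendsto_const, of s 0 _ r] by simp
    ultimately have "A (\<Sum>k. g (s k)) = r" using LIMSEQ_unique by blast
    moreover have "norm (\<Sum>k. g (s k)) \<le> 2 * C * norm r"
    proof -
      have "norm (\<Sum>k. g (s k)) \<le> (\<Sum>k. norm (g (s k)))" by (rule summable_norm[OF sn])
      also have "\<dots> \<le> (\<Sum>k. C * norm r * (1/2) ^ k)"
        by (rule suminf_le[OF bnd sn sums_summable[OF geo]])
      finally show ?thesis using sums_unique[OF geo] by (simp add: mult_ac)
    qed
    ultimately show ?thesis by blast
  qed
  then show ?thesis using that[of "2 * C"] C by simp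
qed

lemma bounded_inverse:
  fixes A :: "'a::chilbert_space \<Rightarrow> 'b::chilbert_space"
  assumes A: "bounded_clinear A" and "inj A" "surj A"
  obtains B where "bounded_clinear B" "\<And>f. B (A f) = f" "\<And>g. A (B g) = g"
proof -
  interpret A: bounded_linear A using A by (simp add: bounded_clinear_def)
  have AC: "A (c *\<^sub>C x) = c *\<^sub>C A x" for c x using A by (simp add: bounded_clinear_def)
  define B where "B = inv_into UNIV A"
  have i: "B (A x) = x" "A (B y) = y" for x y
    using assms by (simp_all add: B_def f_inv_into_f)
  obtain C where C: "C > 0" "\<And>r. r \<in> range A \<Longrightarrow> \<exists>f. A f = r \<and> norm f \<le> C * norm r"
    using closed_range_bounded_preimage[OF A.bounded_linear_axioms] \<open>surj A\<close> by auto
  have c: "B (c *\<^sub>C x) = c *\<^sub>C B x" for c x by (metis AC i)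
  have "bounded_linear B"
  proof (rule bounded_linear_intro[where K = C])
    show "B (x + y) = B x + B y" for x y by (metis A.add i)
    show "B (r *\<^sub>R x) = r *\<^sub>R B x" for r x by (metis A.scaleR i)
    show "norm (B x) \<le> norm x * C" for x
      using C(2)[of x] i \<open>surj A\<close> by (metis UNIV_I mult.commute)
  qed
  then have "bounded_clinear B" using c by (simp add: bounded_clinear_def)
  then show ?thesis using i that by blast
qed

section \<open>Finite orthonormal sets\<close>

definition orthonormal :: "'a::complex_inner set \<Rightarrow> bool" where
  "orthonormal B \<longleftrightarrow> (\<forall>b\<in>B. \<forall>c\<in>B. cinner b c = (if b = c then 1 else 0))"

lemma norm_eq_1_if_orthonormal:
  assumes "orthonormal B" "b \<in> B"
  shows "norm b = 1"
proof -
  have "cinner b b = 1" using assms by (simp add: orthonormal_def)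
  then have "(norm b)\<^sup>2 = 1" using cinner_self[of b] of_real_eq_1_iff by metis
  then show ?thesis by (simp add: power2_eq_1_iff) (use norm_ge_zero[of b] in linarith)
qed

lemma cinner_orthonormal_sum:
  assumes "finite B" "orthonormal B" "b \<in> B"
  shows "cinner b (\<Sum>c\<in>B. a c *\<^sub>C c) = a b"
proof -
  have "cinner b (\<Sum>c\<in>B. a c *\<^sub>C c) = (\<Sum>c\<in>B. if b = c then a c else 0)"
    using assms(2,3)
    by (auto simp: cinner_sum_right cinner_scaleC_right orthonormal_def intro!: sum.cong)
  then show ?thesis using assms(1,3) by simp
qed

text \<open>Only the orthogonal projection of \<open>g\<close> to the span of \<open>B\<close> is seen by elements of that span;
  the inequality is Cauchy-Schwarz for this projection.\<close>

lemma norm_cinner_orthonormal_sum_le: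
  assumes B: "finite B" "orthonormal B"
  shows "(norm (cinner g (\<Sum>b\<in>B. a b *\<^sub>C b)))\<^sup>2
    \<le> (\<Sum>b\<in>B. (norm (cinner b g))\<^sup>2) * (norm (\<Sum>b\<in>B. a b *\<^sub>C b))\<^sup>2"
proof -
  let ?s = "\<Sum>b\<in>B. a b *\<^sub>C b"
  let ?p = "\<Sum>b\<in>B. cinner b g *\<^sub>C b"
  have "cinner ?p ?s = (\<Sum>b\<in>B. cnj (cinner b g) * cinner b ?s)"
    by (simp only: cinner_sum_left cinner_scaleC_left)
  also have "\<dots> = (\<Sum>b\<in>B. cnj (cinner b g) * a b)"
    using cinner_orthonormal_sum[OF B] by (intro sum.cong) auto
  also have "\<dots> = cinner g ?s"
    unfolding cinner_sum_right cinner_scaleC_right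
    by (intro sum.cong refl) (metis cinner_commute mult.commute)
  finally have "(norm (cinner g ?s))\<^sup>2 = (norm (cinner ?p ?s))\<^sup>2" by simp
  also have "\<dots> \<le> (norm ?p * norm ?s)\<^sup>2"
    by (intro power_mono norm_cinner_le) simp
  finally show ?thesis
    using norm_orthonormal_sum[OF B(1) B(2)[unfolded orthonormal_def], of "\<lambda>b. cinner b g"]
    by (simp add: power_mult_distrib)
qed

lemma bessel_inequality:
  assumes B: "finite B" "orthonormal B"
  shows "(\<Sum>b\<in>B. (norm (cinner b x))\<^sup>2) \<le> (norm x)\<^sup>2"
proof -
  let ?p = "\<Sum>b\<in>B. cinner b x *\<^sub>C b"
  have np: "(norm ?p)\<^sup>2 = (\<Sum>b\<in>B. (norm (cinner b x))\<^sup>2)"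
    by (rule norm_orthonormal_sum[OF B(1) B(2)[unfolded orthonormal_def]])
  have "cinner x ?p = (\<Sum>b\<in>B. cinner b x * cnj (cinner b x))"
    unfolding cinner_sum_right cinner_scaleC_right
    by (intro sum.cong refl) (metis cinner_commute)
  also have "\<dots> = complex_of_real ((norm ?p)\<^sup>2)"
    by (simp only: np complex_norm_square of_real_sum)
  finally have "norm (cinner x ?p) = (norm ?p)\<^sup>2"
    by (metis abs_power2 norm_of_real)
  then have "(norm ?p)\<^sup>2 \<le> norm x * norm ?p"
    using norm_cinner_le[of x ?p] by simp
  then have "norm ?p \<le> norm x"
    by (cases "norm ?p = 0") (simp_all add: power2_eq_square)
  then show ?thesis using np power_mono[of "norm ?p" "norm x" 2] by simp
qed

text \<open>A trace estimate. If every element of an orthonormal set has a projection to the span of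
  \<open>B\<close> of norm at least \<open>1 / (2 C)\<close>, then summing Bessel's inequality for \<open>E\<close> over the elements of
  \<open>B\<close> bounds the number of elements of \<open>E\<close> by the dimension of the span. The hypothesis asks for a witness
  in the span instead of the projection itself, since that is what the open mapping theorem
  yields.\<close>

lemma card_orthonormal_le:
  fixes E B :: "'a::complex_inner set"
  assumes B: "finite B" "orthonormal B" and E: "finite E" "orthonormal E"
    and near: "\<And>g. g \<in> E \<Longrightarrow> \<exists>a. norm (\<Sum>b\<in>B. a b *\<^sub>C b) \<le> C \<and>
      1/2 \<le> norm (cinner g (\<Sum>b\<in>B. a b *\<^sub>C b))"
  shows "real (card E) \<le> 4 * C\<^sup>2 * card B"
proof -
  have low: "1 \<le> 4 * C\<^sup>2 * (\<Sum>b\<in>B. (norm (cinner b g))\<^sup>2)" if "g \<in> E" for g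
  proof -
    obtain a where a: "norm (\<Sum>b\<in>B. a b *\<^sub>C b) \<le> C"
      "1/2 \<le> norm (cinner g (\<Sum>b\<in>B. a b *\<^sub>C b))" using near[OF \<open>g \<in> E\<close>] by blast
    have "(1/2)\<^sup>2 \<le> (norm (cinner g (\<Sum>b\<in>B. a b *\<^sub>C b)))\<^sup>2"
      by (intro power_mono a) simp
    also have "\<dots> \<le> (\<Sum>b\<in>B. (norm (cinner b g))\<^sup>2) * (norm (\<Sum>b\<in>B. a b *\<^sub>C b))\<^sup>2"
      by (rule norm_cinner_orthonormal_sum_le[OF B])
    also have "\<dots> \<le> (\<Sum>b\<in>B. (norm (cinner b g))\<^sup>2) * C\<^sup>2"
      using a(1) by (intro mult_left_mono power_mono sum_nonneg) auto
    finally show ?thesis by (simp add: power2_eq_square field_simps)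
  qed
  have sym: "norm (cinner b g) = norm (cinner g b)" for b g :: 'a
    by (metis cinner_commute complex_mod_cnj)
  have "real (card E) = (\<Sum>g\<in>E. 1)" by simp
  also have "\<dots> \<le> (\<Sum>g\<in>E. 4 * C\<^sup>2 * (\<Sum>b\<in>B. (norm (cinner b g))\<^sup>2))"
    by (rule sum_mono) (rule low)
  also have "\<dots> = 4 * C\<^sup>2 * (\<Sum>b\<in>B. \<Sum>g\<in>E. (norm (cinner g b))\<^sup>2)"
    by (subst sum.swap) (simp only: sum_distrib_left sym)
  also have "\<dots> \<le> 4 * C\<^sup>2 * (\<Sum>b\<in>B. (norm b)\<^sup>2)"
    by (intro mult_left_mono sum_mono bessel_inequality E) simp
  also have "(\<Sum>b\<in>B. (norm b)\<^sup>2) = card B"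
    using norm_eq_1_if_orthonormal[OF B(2)] by simp
  finally show ?thesis by simp
qed

lemma cspan_orthonormal_expansion:
  fixes S :: "'a::complex_inner set"
  assumes "finite S"
  obtains B where "finite B" "orthonormal B"
    "\<And>v. v \<in> cspan S \<Longrightarrow> v = (\<Sum>b\<in>B. cinner b v *\<^sub>C b)"
proof -
  obtain B where B: "finite B" "orthonormal B"
    and S: "\<forall>v\<in>S. v = (\<Sum>b\<in>B. cinner b v *\<^sub>C b)"
    using finite_orthonormal_expansion[OF assms] unfolding orthonormal_def by blast
  have "v = (\<Sum>b\<in>B. cinner b v *\<^sub>C b)" if "v \<in> cspan S" for v
    using that
  proof (induction rule: complex_vector.span_induct_alt)
    case (step c x y)
    have "(\<Sum>b\<in>B. cinner b (c *\<^sub>C x + y) *\<^sub>C b)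
        = c *\<^sub>C (\<Sum>b\<in>B. cinner b x *\<^sub>C b) + (\<Sum>b\<in>B. cinner b y *\<^sub>C b)"
      by (simp add: cinner_add_right cinner_scaleC_right scaleC_add_left sum.distrib
          complex_vector.scale_sum_right)
    also have "\<dots> = c *\<^sub>C x + y" using S step by metis
    finally show ?case by simp
  qed simp
  with B that show ?thesis by blast
qed

text \<open>The Riesz lemma, in a form that yields near orthogonality: if \<open>p \<in> R\<close> almost realises the
  distance \<open>d\<close> from a point \<open>v\<close> to \<open>R\<close>, then \<open>u = v - p\<close> cannot be shortened much by adding
  elements of \<open>R\<close>, which bounds its inner products with \<open>R\<close>.\<close>

lemma almost_orthogonal_to_closed_subspace:
  fixes R :: "'a::complex_inner set"
  assumes R: "complex_vector.subspace R" "closed R" "R \<noteq> UNIV" and "\<delta> > 0"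
  obtains g where "norm g = 1" "\<And>r. r \<in> R \<Longrightarrow> norm (cinner g r) \<le> \<delta> * norm r"
proof -
  obtain v where "v \<notin> R" using R(3) by blast
  have ne: "R \<noteq> {}" using complex_vector.subspace_0[OF R(1)] by blast
  define d where "d = infdist v R"
  have d: "d > 0" using \<open>v \<notin> R\<close> infdist_pos_not_in_closed[OF R(2) ne] by (simp add: d_def)
  have "d < d * sqrt (1 + \<delta>\<^sup>2)" using d \<open>\<delta> > 0\<close> by simp
  then obtain p where p: "p \<in> R" "dist v p < d * sqrt (1 + \<delta>\<^sup>2)"
    using cINF_less_iff[of R "dist v"] ne unfolding d_def infdist_notempty[OF ne] by auto
  define u where "u = v - p"
  have far: "d \<le> norm (u + r)" if "r \<in> R" for r
  proof -
    have "p - r \<in> R" using p that complex_vector.subspace_diff[OF R(1)] by blast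
    then have "d \<le> dist v (p - r)" unfolding d_def by (rule infdist_le)
    then show ?thesis by (simp add: u_def dist_norm algebra_simps)
  qed
  have u: "d \<le> norm u" using far[OF complex_vector.subspace_0[OF R(1)]] by simp
  have "(norm u)\<^sup>2 \<le> (d * sqrt (1 + \<delta>\<^sup>2))\<^sup>2"
    using p by (intro power_mono) (auto simp: u_def dist_norm)
  then have u2: "(norm u)\<^sup>2 - d\<^sup>2 \<le> (\<delta> * d)\<^sup>2"
    by (simp add: power_mult_distrib algebra_simps)
  have main: "norm (cinner u r) \<le> \<delta> * norm u * norm r" if r: "r \<in> R" for r
  proof (cases "r = 0")
    case False
    \<comment> \<open>The multiple of \<open>r\<close> that minimises \<open>norm (u + t *\<^sub>C r)\<close>.\<close>
    define t where "t = - (cnj (cinner u r) / complex_of_real ((norm r)\<^sup>2))"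
    have nr: "norm r > 0" using False by simp
    have "d\<^sup>2 \<le> (norm (u + t *\<^sub>C r))\<^sup>2"
      using far[OF complex_vector.subspace_scale[OF R(1) r, of t]] d by (intro power_mono) auto
    also have "\<dots> = (norm u)\<^sup>2 + (norm t * norm r)\<^sup>2 + 2 * Re (t * cinner u r)"
      by (simp add: norm_add_sq cinner_scaleC_right)
    also have "norm t = norm (cinner u r) / (norm r)\<^sup>2"
      by (simp add: t_def norm_divide norm_power)
    also have "t * cinner u r = - complex_of_real ((norm (cinner u r))\<^sup>2 / (norm r)\<^sup>2)"
      by (simp add: t_def complex_norm_square mult.commute del: of_real_power)
    also have "(norm (cinner u r) / (norm r)\<^sup>2 * norm r)\<^sup>2 = (norm (cinner u r))\<^sup>2 / (norm r)\<^sup>2"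
      using nr by (simp add: power2_eq_square)
    finally have "(norm (cinner u r))\<^sup>2 / (norm r)\<^sup>2 \<le> (norm u)\<^sup>2 - d\<^sup>2" by simp
    also note u2
    also have "(\<delta> * d)\<^sup>2 \<le> (\<delta> * norm u)\<^sup>2"
      using u d \<open>\<delta> > 0\<close> by (intro power_mono mult_left_mono) auto
    finally have "(norm (cinner u r))\<^sup>2 \<le> (\<delta> * norm u * norm r)\<^sup>2"
      using nr by (simp add: field_simps power_mult_distrib)
    then show ?thesis by (rule power2_le_imp_le) (use \<open>\<delta> > 0\<close> in simp)
  qed simp
  show ?thesis
  proof (rule that)
    let ?g = "complex_of_real (inverse (norm u)) *\<^sub>C u"
    have nu: "norm u > 0" using u d by linarith
    then show "norm ?g = 1" by (simp add: norm_inverse)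
    show "norm (cinner ?g r) \<le> \<delta> * norm r" if "r \<in> R" for r
      using main[OF that] nu by (simp add: cinner_scaleC_left norm_mult norm_divide norm_inverse field_simps)
  qed
qed

section \<open>Approximate null vectors of Fredholm operators\<close>

lemma bounded_linear_cinner_right: "bounded_linear (cinner (b::'a::complex_inner))"
proof (rule bounded_linear_intro[where K = "norm b"])
  show "cinner b (r *\<^sub>R x) = r *\<^sub>R cinner b x" for r x
    using cinner_scaleC_right[of b "complex_of_real r" x]
    by (simp add: scaleC_of_real scaleR_conv_of_real)
qed (simp_all add: cinner_add_right norm_cinner_le mult.commute[of _ "norm b"])

text \<open>An approximate null vector \<open>g\<close> is close to the kernel: \<open>A g\<close> has a preimage \<open>f\<close> of small norm,
  and \<open>g - f\<close> lies in the kernel, which is finite-dimensional.\<close>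

lemma fredholm_almost_kernel_card_le:
  fixes A :: "'a::chilbert_space \<Rightarrow> 'b::chilbert_space"
  assumes "fredholm A"
  obtains \<delta> N where "\<delta> > 0" "\<And>E. finite E \<Longrightarrow> orthonormal E \<Longrightarrow>
    (\<And>g. g \<in> E \<Longrightarrow> norm (A g) \<le> \<delta>) \<Longrightarrow> card E \<le> N"
proof -
  have A: "bounded_linear A" and cl: "closed (range A)"
    using assms by (auto simp: fredholm_def bounded_clinear_def)
  interpret A: bounded_linear A by fact
  obtain S where S: "finite S" "{f. A f = 0} \<subseteq> cspan S"
    using assms by (auto simp: fredholm_def)
  obtain B where B: "finite B" "orthonormal B"
    "\<And>v. v \<in> cspan S \<Longrightarrow> v = (\<Sum>b\<in>B. cinner b v *\<^sub>C b)"
    using cspan_orthonormal_expansion[OF S(1)] by metis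
  obtain C where C: "C > 0" "\<And>r. r \<in> range A \<Longrightarrow> \<exists>f. A f = r \<and> norm f \<le> C * norm r"
    using closed_range_bounded_preimage[OF A cl] by metis
  show ?thesis
  proof (rule that[of "1 / (2 * C)" "9 * card B"])
    fix E assume E: "finite E" "orthonormal E" and AE: "\<And>g. g \<in> E \<Longrightarrow> norm (A g) \<le> 1 / (2 * C)"
    have "real (card E) \<le> 4 * (3/2)\<^sup>2 * card B"
    proof (rule card_orthonormal_le[OF B(1,2) E])
      fix g assume g: "g \<in> E"
      obtain f where f: "A f = A g" "norm f \<le> C * norm (A g)" using C(2) by blast
      have "C * norm (A g) \<le> C * (1 / (2 * C))"
        using AE[OF g] C(1) by (intro mult_left_mono) auto
      then have nf: "norm f \<le> 1/2" using f(2) C(1) by simp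
      have ng: "norm g = 1" using norm_eq_1_if_orthonormal[OF E(2) g] .
      have "A (g - f) = 0" using f by (simp add: A.diff)
      then have k: "g - f = (\<Sum>b\<in>B. cinner b (g - f) *\<^sub>C b)" using S B(3) by blast
      have "norm (g - f) \<le> 3/2" using norm_triangle_ineq4[of g f] nf ng by simp
      moreover have "1/2 \<le> norm (cinner g (g - f))"
      proof -
        have "cinner g (g - f) = 1 - cinner g f" using ng by (simp add: cinner_diff_right cinner_self)
        then have "1 - norm (cinner g f) \<le> norm (cinner g (g - f))"
          using norm_triangle_ineq2[of 1 "cinner g f"] by simp
        then show ?thesis using norm_cinner_le[of g f] ng nf by simp
      qed
      ultimately show "\<exists>a. norm (\<Sum>b\<in>B. a b *\<^sub>C b) \<le> 3/2 \<and> 1/2 \<le> norm (cinner g (\<Sum>b\<in>B. a b *\<^sub>C b))"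
        using k by (intro exI[of _ "\<lambda>b. cinner b (g - f)"]) simp
    qed
    also have "\<dots> = real (9 * card B)" by (simp add: power2_eq_square)
    finally show "card E \<le> 9 * card B" by linarith
  qed (use C in simp)
qed

text \<open>Let \<open>P\<close> be the orthogonal projection to a finite-dimensional space that together with the
  range spans everything. Then \<open>(f, w) \<mapsto> A f + P w\<close> is surjective, so \<open>g = A f + P w\<close> with bounded \<open>f\<close> and \<open>w\<close>. If \<open>g\<close> is almost
  orthogonal to the range of \<open>A\<close>, then \<open>\<langle>g, P w\<rangle>\<close> must account for most of \<open>\<langle>g, g\<rangle> = 1\<close>.\<close>

lemma fredholm_almost_cokernel_card_le:
  fixes A :: "'a::chilbert_space \<Rightarrow> 'b::chilbert_space"
  assumes "fredholm A"
  obtains \<delta> N where "\<delta> > 0" "\<And>E. finite E \<Longrightarrow> orthonormal E \<Longrightarrow>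
    (\<And>g h. g \<in> E \<Longrightarrow> norm (cinner g (A h)) \<le> \<delta> * norm h) \<Longrightarrow> card E \<le> N"
proof -
  have A: "bounded_linear A" using assms by (auto simp: fredholm_def bounded_clinear_def)
  obtain S where S: "finite S" "\<And>g. \<exists>f. g - A f \<in> cspan S"
    using assms by (auto simp: fredholm_def)
  obtain B where B: "finite B" "orthonormal B"
    "\<And>v. v \<in> cspan S \<Longrightarrow> v = (\<Sum>b\<in>B. cinner b v *\<^sub>C b)"
    using cspan_orthonormal_expansion[OF S(1)] by metis
  define P where "P w = (\<Sum>b\<in>B. cinner b w *\<^sub>C b)" for w
  have "bounded_linear (\<lambda>p::'a \<times> 'b. A (fst p) + P (snd p))"
    unfolding P_def
    by (intro bounded_linear_add bounded_linear_sum bounded_linear_compose[OF A bounded_linear_fst]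
        bounded_linear_compose[OF bounded_linear_scaleC_left]
        bounded_linear_compose[OF bounded_linear_cinner_right bounded_linear_snd])
  moreover have "range (\<lambda>p::'a \<times> 'b. A (fst p) + P (snd p)) = UNIV"
  proof (rule surjI)
    fix g
    obtain f where "g - A f \<in> cspan S" using S(2) by blast
    then have "A f + P (g - A f) = g" using B(3) by (simp add: P_def)
    then show "A (fst (SOME p. A (fst p) + P (snd p) = g)) + P (snd (SOME p. A (fst p) + P (snd p) = g)) = g"
      by (intro someI[of "\<lambda>p. A (fst p) + P (snd p) = g" "(f, g - A f)"]) simp
  qed
  ultimately obtain C where C: "C > 0"
    "\<And>g. \<exists>p::'a \<times> 'b. A (fst p) + P (snd p) = g \<and> norm p \<le> C * norm g"
    using closed_range_bounded_preimage[of "\<lambda>p::'a \<times> 'b. A (fst p) + P (snd p)"]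
    by (metis closed_UNIV UNIV_I)
  show ?thesis
  proof (rule that[of "1 / (2 * C)" "nat \<lceil>4 * C\<^sup>2 * card B\<rceil>"])
    fix E assume E: "finite E" "orthonormal E"
      and AE: "\<And>g h. g \<in> E \<Longrightarrow> norm (cinner g (A h)) \<le> 1 / (2 * C) * norm h"
    have "real (card E) \<le> 4 * C\<^sup>2 * card B"
    proof (rule card_orthonormal_le[OF B(1,2) E])
      fix g assume g: "g \<in> E"
      have ng: "norm g = 1" using norm_eq_1_if_orthonormal[OF E(2) g] .
      obtain f w where fw: "A f + P w = g" "norm (f, w) \<le> C" using C(2)[of g] ng by force
      have nf: "norm f \<le> C" and nw: "norm w \<le> C"
        using norm_fst_le[of f w] norm_snd_le[of w f] fw(2) by auto
      have "(norm (P w))\<^sup>2 \<le> (norm w)\<^sup>2"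
        using bessel_inequality[OF B(1,2), of w] norm_orthonormal_sum[OF B(1) B(2)[unfolded orthonormal_def]]
        by (simp add: P_def)
      then have "norm (P w) \<le> C" using nw power2_le_imp_le by fastforce
      moreover have "1/2 \<le> norm (cinner g (P w))"
      proof -
        have "P w = g - A f" using fw(1) by (simp add: algebra_simps)
        then have "cinner g (P w) = 1 - cinner g (A f)"
          using ng by (simp add: cinner_diff_right cinner_self)
        then have "1 - norm (cinner g (A f)) \<le> norm (cinner g (P w))"
          using norm_triangle_ineq2[of 1 "cinner g (A f)"] by simp
        moreover have "1 / (2 * C) * norm f \<le> 1/2" using nf C(1) by (simp add: field_simps)
        ultimately show ?thesis using AE[OF g, of f] by linarith
      qed
      ultimately show "\<exists>a. norm (\<Sum>b\<in>B. a b *\<^sub>C b) \<le> C \<and> 1/2 \<le> norm (cinner g (\<Sum>b\<in>B. a b *\<^sub>C b))"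
        unfolding P_def by (intro exI[of _ "\<lambda>b. cinner b w"] conjI)
    qed
    then show "card E \<le> nat \<lceil>4 * C\<^sup>2 * card B\<rceil>" by linarith
  qed (use C in simp)
qed

text \<open>The inverse of a bijective bounded operator is bounded by the open mapping theorem, so a
  point of the spectrum means a nonzero kernel or a proper range, and the range is closed. Almost
  orthogonality to the range is enough in the second case, since the vector is going to be
  perturbed anyway.\<close>

lemma fredholm_spectrum_cases:
  fixes A :: "'a::chilbert_space \<Rightarrow> 'a"
  assumes fr: "fredholm (\<lambda>f. A f - z *\<^sub>C f)" and z: "z \<in> spectrum A"
  obtains f where "norm f = 1" "A f - z *\<^sub>C f = 0"
  | "\<And>\<delta>. \<delta> > 0 \<Longrightarrow> \<exists>g. norm g = 1 \<and> (\<forall>h. norm (cinner g (A h - z *\<^sub>C h)) \<le> \<delta> * norm h)"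
proof -
  define T where "T f = A f - z *\<^sub>C f" for f
  have "fredholm T" using fr unfolding T_def .
  then have T: "bounded_clinear T" and cl: "closed (range T)"
    by (auto simp: fredholm_def)
  interpret T: bounded_linear T using T by (simp add: bounded_clinear_def)
  have TC: "T (c *\<^sub>C x) = c *\<^sub>C T x" for c x using T by (simp add: bounded_clinear_def)
  show ?thesis
  proof (cases "inj T")
    case False
    then obtain k where k: "T k = 0" "k \<noteq> 0"
      by (metis T.diff eq_iff_diff_eq_0 injI)
    let ?f = "complex_of_real (inverse (norm k)) *\<^sub>C k"
    have "T ?f = 0" by (simp add: TC k)
    moreover have "norm ?f = 1" using k by (simp add: norm_inverse)
    ultimately show ?thesis using that(1)[of ?f] by (simp only: T_def)
  next
    case True
    have "range T \<noteq> UNIV"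
    proof
      assume "range T = UNIV"
      then obtain B where "bounded_clinear B" "\<forall>f. B (T f) = f" "\<forall>f. T (B f) = f"
        using bounded_inverse[OF T True] by metis
      then show False using z unfolding spectrum_def T_def by blast
    qed
    have sub: "complex_vector.subspace (range T)"
    proof (rule complex_vector.subspaceI)
      show "0 \<in> range T" using T.zero by (metis rangeI)
      show "x + y \<in> range T" if "x \<in> range T" "y \<in> range T" for x y
        using that by (auto simp flip: T.add)
      show "c *\<^sub>C x \<in> range T" if "x \<in> range T" for c x
        using that by (auto simp flip: TC)
    qed
    obtain K where K: "K > 0" "\<And>h. norm (T h) \<le> K * norm h"
      using T.pos_bounded by (metis mult.commute)
    have "\<exists>g. norm g = 1 \<and> (\<forall>h. norm (cinner g (T h)) \<le> \<delta> * norm h)" if "\<delta> > 0" for \<delta>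
    proof -
      obtain g where g: "norm g = 1" "\<And>r. r \<in> range T \<Longrightarrow> norm (cinner g r) \<le> \<delta> / K * norm r"
        using almost_orthogonal_to_closed_subspace[OF sub cl \<open>range T \<noteq> UNIV\<close>, of "\<delta> / K"]
          \<open>\<delta> > 0\<close> K(1) by (metis divide_pos_pos)
      have "norm (cinner g (T h)) \<le> \<delta> * norm h" for h
      proof -
        have "norm (cinner g (T h)) \<le> \<delta> / K * norm (T h)" using g(2) by blast
        also have "\<dots> \<le> \<delta> / K * (K * norm h)"
          using K \<open>\<delta> > 0\<close> by (intro mult_left_mono) auto
        finally show ?thesis using K(1) by simp
      qed
      with g(1) show ?thesis by blast
    qed
    then show ?thesis using that(2) unfolding T_def by blast
  qed
qed

section \<open>Multiplication operators and finitely supported vectors\<close>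

lemma ell2_eqI: "(\<And>x. Rep_ell2 f x = Rep_ell2 g x) \<Longrightarrow> f = g"
  by (intro Rep_ell2_inject[THEN iffD1] ext)

lemma norm_mult_op_le:
  assumes V: "\<And>x. norm (V x) \<le> b"
  shows "norm (mult_op V f) \<le> b * norm f"
proof (rule norm_ell2_leI)
  fix F :: "'a set" assume F: "finite F"
  have b: "0 \<le> b" using V[of undefined] norm_ge_zero order_trans by blast
  have bd: "bounded (range V)" using V by (auto simp: bounded_iff)
  have "L2_set (\<lambda>x. norm (Rep_ell2 (mult_op V f) x)) F \<le> L2_set (\<lambda>x. b * norm (Rep_ell2 f x)) F"
  proof (rule L2_set_mono)
    show "norm (Rep_ell2 (mult_op V f) x) \<le> b * norm (Rep_ell2 f x)" for x
      unfolding Rep_mult_op[OF bd]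
      by (rule order_trans[OF norm_blinfun mult_right_mono[OF V]]) simp
  qed simp
  also have "\<dots> \<le> b * norm f"
    using mult_left_mono[OF L2_set_Rep_ell2_le[OF F, of f] b] b by (simp add: L2_set_right_distrib)
  finally show "L2_set (\<lambda>x. norm (Rep_ell2 (mult_op V f) x)) F \<le> b * norm f" .
qed

text \<open>The multiplication operator may be replaced by one that vanishes outside \<open>F\<close>, and this one
  has norm at most \<open>\<epsilon>\<close>. The second inequality is the first one for the adjoint operator.\<close>

lemma norm_mult_op_le_on_support:
  assumes bd: "bounded (range D)" and D: "\<And>x. x \<in> F \<Longrightarrow> norm (D x) \<le> \<epsilon>" and "\<epsilon> \<ge> 0"
    and f: "\<And>x. x \<notin> F \<Longrightarrow> Rep_ell2 f x = 0"
  shows "norm (mult_op D f) \<le> \<epsilon> * norm f"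
    and "norm (cinner f (mult_op D h)) \<le> \<epsilon> * norm f * norm h"
proof -
  define D' where "D' x = (if x \<in> F then D x else 0)" for x
  have D': "norm (D' x) \<le> \<epsilon>" for x using D \<open>\<epsilon> \<ge> 0\<close> by (simp add: D'_def)
  then have bd': "bounded (range D')" by (auto simp: bounded_iff)
  have "mult_op D f = mult_op D' f"
    using f by (intro ell2_eqI) (simp add: Rep_mult_op[OF bd] Rep_mult_op[OF bd'] D'_def)
  then show "norm (mult_op D f) \<le> \<epsilon> * norm f" using norm_mult_op_le[OF D'] by simp
  have "cinner f (mult_op D h) = cinner f (mult_op D' h)"
    unfolding cinner_ell2.rep_eq Rep_mult_op[OF bd] Rep_mult_op[OF bd']
    using f by (intro infsum_cong) (simp add: D'_def)
  then have "norm (cinner f (mult_op D h)) \<le> norm f * norm (mult_op D' h)"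
    using norm_cinner_le[of f "mult_op D' h"] by simp
  also have "\<dots> \<le> norm f * (\<epsilon> * norm h)"
    by (intro mult_left_mono norm_mult_op_le[OF D']) simp
  finally show "norm (cinner f (mult_op D h)) \<le> \<epsilon> * norm f * norm h" by (simp add: mult_ac)
qed

lemma finitely_supported_unit_approx:
  fixes f :: "('x, 'k::complex_inner) ell2"
  assumes "norm f = 1" "\<eta> > 0"
  obtains F f' where "finite F" "\<And>x. x \<notin> F \<Longrightarrow> Rep_ell2 f' x = 0" "norm f' = 1" "norm (f' - f) \<le> \<eta>"
proof -
  \<comment> \<open>Truncation and normalisation each cost at most \<open>\<eta>'\<close>; the bound \<open>1/2\<close> keeps the truncation nonzero.\<close>
  define \<eta>' where "\<eta>' = min (\<eta> / 2) (1 / 2)"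
  have \<eta>': "\<eta>' > 0" "\<eta>' \<le> \<eta> / 2" "\<eta>' \<le> 1/2" using assms(2) by (auto simp: \<eta>'_def)
  have "\<forall>\<^sub>F F in finite_subsets_at_top UNIV. dist (\<Sum>y\<in>F. single_ell2 y (Rep_ell2 f y)) f < \<eta>'"
    using has_sum_single_ell2[of f] \<eta>'(1) unfolding has_sum_def by (rule tendstoD)
  then obtain F where F: "finite F" "dist (\<Sum>y\<in>F. single_ell2 y (Rep_ell2 f y)) f < \<eta>'"
    unfolding eventually_finite_subsets_at_top by blast
  define f0 where "f0 = (\<Sum>y\<in>F. single_ell2 y (Rep_ell2 f y))"
  have d: "norm (f0 - f) < \<eta>'" using F(2) by (simp add: f0_def dist_norm)
  have "\<bar>norm f0 - 1\<bar> \<le> norm (f0 - f)" using norm_triangle_ineq3[of f0 f] assms(1) by simp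
  then have n: "\<bar>norm f0 - 1\<bar> < \<eta>'" and n0: "norm f0 > 0" using d \<eta>' by linarith+
  define f' where "f' = complex_of_real (inverse (norm f0)) *\<^sub>C f0"
  have "f' - f0 = (inverse (norm f0) - 1) *\<^sub>R f0"
    unfolding f'_def scaleC_of_real by (simp add: scaleR_left_diff_distrib)
  then have "norm (f' - f0) = \<bar>(inverse (norm f0) - 1) * norm f0\<bar>" by (simp add: abs_mult)
  also have "\<dots> = \<bar>norm f0 - 1\<bar>" using n0 by (simp add: left_diff_distrib abs_minus_commute)
  finally have "norm (f' - f) \<le> \<eta>"
    using norm_triangle_ineq[of "f' - f0" "f0 - f"] n d \<eta>'(2) by simp
  moreover have "norm f' = 1" using n0 by (simp add: f'_def norm_inverse)
  moreover have "Rep_ell2 f' x = 0" if "x \<notin> F" for x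
    using that by (simp add: f'_def scaleC_ell2.rep_eq f0_def Rep_sum_single[OF F(1)])
  ultimately show ?thesis using that F(1) by blast
qed

section \<open>Translations\<close>

lemma action_inv:
  assumes "group_action G (UNIV :: 'x set) \<phi>" "\<gamma> \<in> carrier G"
  shows "\<phi> \<gamma> (\<phi> (inv\<^bsub>G\<^esub> \<gamma>) x) = x" "\<phi> (inv\<^bsub>G\<^esub> \<gamma>) (\<phi> \<gamma> x) = x"
proof -
  interpret group_action G "UNIV :: 'x set" \<phi> by fact
  interpret group G using group_hom group_hom.axioms(1) by blast
  have "\<phi> \<one>\<^bsub>G\<^esub> x = x" for x using id_eq_one by (metis UNIV_I restrict_apply)
  then show "\<phi> \<gamma> (\<phi> (inv\<^bsub>G\<^esub> \<gamma>) x) = x" "\<phi> (inv\<^bsub>G\<^esub> \<gamma>) (\<phi> \<gamma> x) = x"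
    using composition_rule[of x \<gamma> "inv\<^bsub>G\<^esub> \<gamma>"] composition_rule[of x "inv\<^bsub>G\<^esub> \<gamma>" \<gamma>] assms(2) by simp_all
qed

lemma action_inv_bij:
  assumes "group_action G (UNIV :: 'x set) \<phi>" "\<gamma> \<in> carrier G"
  shows "bij_betw (\<phi> (inv\<^bsub>G\<^esub> \<gamma>)) UNIV UNIV"
  by (rule bij_betw_byWitness[where f' = "\<phi> \<gamma>"]) (auto simp: action_inv[OF assms])

lemma bounded_clinear_tensor_id:
  "bounded_clinear H0 \<Longrightarrow> bounded_clinear (tensor_id H0 :: ('x, 'k::chilbert_space) ell2 \<Rightarrow> _)"
  unfolding tensor_id_def using theI'[OF tensor_id_ex1] by blast

lemma tensor_id_elem_tensor:
  fixes k :: "'k::chilbert_space"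
  shows "bounded_clinear H0 \<Longrightarrow> tensor_id H0 (elem_tensor \<psi> k) = elem_tensor (H0 \<psi>) k"
  unfolding tensor_id_def using theI'[OF tensor_id_ex1] by blast

lemma tensor_id_unique:
  fixes T :: "('x, 'k::chilbert_space) ell2 \<Rightarrow> ('x, 'k) ell2"
  assumes "bounded_clinear H0" "bounded_clinear T"
    "\<And>\<psi> k. T (elem_tensor \<psi> k) = elem_tensor (H0 \<psi>) k"
  shows "tensor_id H0 = T"
  unfolding tensor_id_def using assms by (intro the1_equality tensor_id_ex1) auto

context
  fixes G :: "('g, 'm) monoid_scheme" and \<phi> :: "'g \<Rightarrow> 'x \<Rightarrow> 'x" and \<gamma> :: 'g
  assumes act: "group_action G (UNIV :: 'x set) \<phi>" and \<gamma>: "\<gamma> \<in> carrier G"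
begin

lemma action_inv_carrier: "inv\<^bsub>G\<^esub> \<gamma> \<in> carrier G" "inv\<^bsub>G\<^esub> (inv\<^bsub>G\<^esub> \<gamma>) = \<gamma>"
proof -
  interpret group_action G "UNIV :: 'x set" \<phi> by (rule act)
  interpret group G using group_hom group_hom.axioms(1) by blast
  show "inv\<^bsub>G\<^esub> \<gamma> \<in> carrier G" "inv\<^bsub>G\<^esub> (inv\<^bsub>G\<^esub> \<gamma>) = \<gamma>" using \<gamma> by simp_all
qed

lemmas Rep_translation_at = Rep_translation[OF act \<gamma>]
lemmas Rep_translation_inv_at = Rep_translation[OF act action_inv_carrier(1), unfolded action_inv_carrier(2)]

lemma cinner_translation:
  fixes f g :: "('x, 'k::complex_inner) ell2"
  shows "cinner (translation G \<phi> \<gamma> f) (translation G \<phi> \<gamma> g) = cinner f g"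
  unfolding cinner_ell2.rep_eq Rep_translation_at
  by (rule infsum_reindex_bij_betw[OF action_inv_bij[OF act \<gamma>]])

lemma norm_translation:
  fixes f :: "('x, 'k::complex_inner) ell2"
  shows "norm (translation G \<phi> \<gamma> f) = norm f"
  unfolding norm_ell2.rep_eq Rep_translation_at
  by (subst infsum_reindex_bij_betw[OF action_inv_bij[OF act \<gamma>], of "\<lambda>x. (norm (Rep_ell2 f x))\<^sup>2"]) simp

lemma translation_translation_inv:
  fixes f :: "('x, 'k::complex_inner) ell2"
  shows "translation G \<phi> \<gamma> (translation G \<phi> (inv\<^bsub>G\<^esub> \<gamma>) f) = f"
    and "translation G \<phi> (inv\<^bsub>G\<^esub> \<gamma>) (translation G \<phi> \<gamma> f) = f"
  by (auto intro!: ell2_eqI simp: Rep_translation_at Rep_translation_inv_at action_inv[OF act \<gamma>])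

lemma translation_add:
  fixes f g :: "('x, 'k::complex_inner) ell2"
  shows "translation G \<phi> \<gamma> (f + g) = translation G \<phi> \<gamma> f + translation G \<phi> \<gamma> g"
  by (intro ell2_eqI) (simp add: Rep_translation_at plus_ell2.rep_eq)

lemma translation_diff:
  fixes f g :: "('x, 'k::complex_inner) ell2"
  shows "translation G \<phi> \<gamma> (f - g) = translation G \<phi> \<gamma> f - translation G \<phi> \<gamma> g"
  by (intro ell2_eqI) (simp add: Rep_translation_at minus_ell2.rep_eq)

lemma translation_scaleC:
  fixes f :: "('x, 'k::complex_inner) ell2"
  shows "translation G \<phi> \<gamma> (c *\<^sub>C f) = c *\<^sub>C translation G \<phi> \<gamma> f"
  by (intro ell2_eqI) (simp add: Rep_translation_at scaleC_ell2.rep_eq)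

lemma bounded_clinear_translation:
  "bounded_clinear (translation G \<phi> \<gamma> :: ('x, 'k::complex_inner) ell2 \<Rightarrow> ('x, 'k) ell2)"
  unfolding bounded_clinear_def
proof
  show "bounded_linear (translation G \<phi> \<gamma> :: ('x, 'k::complex_inner) ell2 \<Rightarrow> ('x, 'k) ell2)"
    by (rule bounded_linear_intro[where K = 1])
       (simp_all add: translation_add translation_scaleC norm_translation flip: scaleC_of_real)
qed (simp add: translation_scaleC)

lemma translation_elem_tensor:
  fixes k :: "'k::complex_inner"
  shows "translation G \<phi> \<gamma> (elem_tensor \<psi> k) = elem_tensor (translation G \<phi> \<gamma> \<psi>) k"
  by (intro ell2_eqI) (simp add: Rep_translation_at elem_tensor.rep_eq)

lemma mult_op_translation:
  fixes f :: "('x, 'k::complex_inner) ell2"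
  assumes "bounded (range V)"
  shows "mult_op V (translation G \<phi> \<gamma> f) = translation G \<phi> \<gamma> (mult_op (\<lambda>x. V (\<phi> \<gamma> x)) f)"
proof -
  have bd: "bounded (range (\<lambda>x. V (\<phi> \<gamma> x)))" by (rule bounded_subset[OF assms]) auto
  show ?thesis
    by (intro ell2_eqI) (simp add: Rep_mult_op[OF assms] Rep_mult_op[OF bd] Rep_translation_at action_inv[OF act \<gamma>])
qed

end

text \<open>Conjugating \<open>H\<^sub>0 \<otimes> I\<close> by a translation gives an operator with the defining property of
  \<open>H\<^sub>0 \<otimes> I\<close>, because \<open>H\<^sub>0\<close> commutes with the translation; so uniqueness applies.\<close>

lemma tensor_id_translation:
  fixes f :: "('x, 'k::chilbert_space) ell2"
  assumes act: "group_action G (UNIV :: 'x set) \<phi>" and \<gamma>: "\<gamma> \<in> carrier G"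
    and H0: "bounded_clinear H0"
    and comm: "\<And>\<psi>. H0 (translation G \<phi> \<gamma> \<psi>) = translation G \<phi> \<gamma> (H0 \<psi>)"
  shows "tensor_id H0 (translation G \<phi> \<gamma> f) = translation G \<phi> \<gamma> (tensor_id H0 f)"
proof -
  let ?U = "translation G \<phi> \<gamma> :: ('x, 'k) ell2 \<Rightarrow> ('x, 'k) ell2"
  let ?U' = "translation G \<phi> (inv\<^bsub>G\<^esub> \<gamma>) :: ('x, 'k) ell2 \<Rightarrow> ('x, 'k) ell2"
  define T where "T f = ?U' (tensor_id H0 (?U f))" for f
  note t = bounded_clinear_tensor_id[OF H0, where 'k = 'k]
  note u = bounded_clinear_translation[OF act \<gamma>, where 'k = 'k]
  note u' = bounded_clinear_translation[OF act action_inv_carrier(1)[OF act \<gamma>], where 'k = 'k]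
  have "bounded_clinear T"
    using bounded_linear_compose[OF _ bounded_linear_compose, of ?U' "tensor_id H0" ?U] t u u'
    unfolding bounded_clinear_def T_def by simp
  then have "tensor_id H0 = T"
  proof (rule tensor_id_unique[OF H0])
    show "T (elem_tensor \<psi> k) = elem_tensor (H0 \<psi>) k" for \<psi> k
      by (simp add: T_def translation_elem_tensor[OF act \<gamma>] tensor_id_elem_tensor[OF H0] comm
          translation_elem_tensor[OF act action_inv_carrier(1)[OF act \<gamma>]] translation_translation_inv[OF act \<gamma>])
  qed
  then have "?U (tensor_id H0 f) = ?U (T f)" by simp
  then show ?thesis by (simp add: T_def translation_translation_inv[OF act \<gamma>])
qed

section \<open>Recurrence of finite patterns\<close>

text \<open>Choose \<open>\<alpha>\<close> and \<open>\<beta>\<close> such that \<open>V\<close> is close to \<open>a\<close> on \<open>\<alpha> F\<close> and close to \<open>b\<close> on \<open>\<beta> F\<close>. No point can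
  lie in both translates, so translating both by the inverse of \<open>\<alpha>\<close> gives the claim.\<close>

lemma disjoint_translate:
  assumes act: "group_action G (UNIV :: 'x set) \<phi>" and pe: "pseudo_ergodic G \<phi> M V"
    and ab: "a \<in> M" "b \<in> M" "a \<noteq> b" and F: "finite F"
  obtains \<gamma> where "\<gamma> \<in> carrier G" "\<phi> \<gamma> ` F \<inter> F = {}"
proof -
  interpret group_action G "UNIV :: 'x set" \<phi> by fact
  interpret group G using group_hom group_hom.axioms(1) by blast
  have e: "norm (a - b) / 2 > 0" using ab(3) by simp
  have rec: "\<exists>\<gamma>\<in>carrier G. \<forall>x\<in>F. norm (c - V (\<phi> \<gamma> x)) < norm (a - b) / 2" if "c \<in> M" for c
    using pe[unfolded pseudo_ergodic_def, THEN conjunct2, rule_format, OF e F, of "\<lambda>_. c"] that by blast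
  obtain \<alpha> where \<alpha>: "\<alpha> \<in> carrier G" "\<And>x. x \<in> F \<Longrightarrow> norm (a - V (\<phi> \<alpha> x)) < norm (a - b) / 2"
    using rec[OF ab(1)] by blast
  obtain \<beta> where \<beta>: "\<beta> \<in> carrier G" "\<And>x. x \<in> F \<Longrightarrow> norm (b - V (\<phi> \<beta> x)) < norm (a - b) / 2"
    using rec[OF ab(2)] by blast
  have "\<phi> (inv\<^bsub>G\<^esub> \<alpha> \<otimes>\<^bsub>G\<^esub> \<beta>) x \<notin> F" if "x \<in> F" for x
  proof
    assume y: "\<phi> (inv\<^bsub>G\<^esub> \<alpha> \<otimes>\<^bsub>G\<^esub> \<beta>) x \<in> F"
    have eq: "\<phi> \<alpha> (\<phi> (inv\<^bsub>G\<^esub> \<alpha> \<otimes>\<^bsub>G\<^esub> \<beta>) x) = \<phi> \<beta> x"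
      using composition_rule[of x "inv\<^bsub>G\<^esub> \<alpha>" \<beta>] \<alpha>(1) \<beta>(1) action_inv[OF act \<alpha>(1)] by simp
    have "norm (a - b) = norm ((a - V (\<phi> \<beta> x)) - (b - V (\<phi> \<beta> x)))" by simp
    also have "\<dots> \<le> norm (a - V (\<phi> \<beta> x)) + norm (b - V (\<phi> \<beta> x))" by (rule norm_triangle_ineq4)
    also have "\<dots> < norm (a - b)" using \<alpha>(2)[OF y] \<beta>(2)[OF that] eq by simp
    finally show False by simp
  qed
  then show ?thesis using that[of "inv\<^bsub>G\<^esub> \<alpha> \<otimes>\<^bsub>G\<^esub> \<beta>"] \<alpha>(1) \<beta>(1) by auto
qed

lemma many_disjoint_translates:
  assumes act: "group_action G (UNIV :: 'x set) \<phi>" and pe: "pseudo_ergodic G \<phi> M V"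
    and ab: "a \<in> M" "b \<in> M" "a \<noteq> b" and F: "finite F" "F \<noteq> {}"
  shows "\<exists>T\<subseteq>carrier G. finite T \<and> card T = n \<and> disjoint_family_on (\<lambda>\<gamma>. \<phi> \<gamma> ` F) T"
proof (induction n)
  case 0
  show ?case by (intro exI[of _ "{}"]) (simp add: disjoint_family_on_def)
next
  case (Suc n)
  then obtain T where T: "T \<subseteq> carrier G" "finite T" "card T = n" "disjoint_family_on (\<lambda>\<gamma>. \<phi> \<gamma> ` F) T"
    by blast
  \<comment> \<open>\<open>F\<close> is included so that \<open>\<phi> \<beta> ` F\<close> is part of what gets moved away from the earlier translates.\<close>
  let ?E = "F \<union> (\<Union>\<gamma>\<in>T. \<phi> \<gamma> ` F)"
  obtain \<beta> where \<beta>: "\<beta> \<in> carrier G" "\<phi> \<beta> ` ?E \<inter> ?E = {}"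
    using disjoint_translate[OF act pe ab, of ?E] F T(2) by blast
  then have disj: "\<phi> \<beta> ` F \<inter> \<phi> \<gamma> ` F = {}" if "\<gamma> \<in> T" for \<gamma> using that by blast
  then have "\<beta> \<notin> T" using F(2) by blast
  moreover have "disjoint_family_on (\<lambda>\<gamma>. \<phi> \<gamma> ` F) (insert \<beta> T)"
    using T(4) disj unfolding disjoint_family_on_def by blast
  ultimately show ?case using T \<beta>(1) by (intro exI[of _ "insert \<beta> T"]) auto
qed

text \<open>Since the sets \<open>\<gamma> F\<close> for \<open>\<gamma> \<in> T\<close> are disjoint, there is a pattern \<open>W\<close> on their union that is a
  copy of \<open>V|F\<close> on each of them. A translation by \<open>\<beta>\<close> under which \<open>V\<close> approximates \<open>W\<close> produces the
  family \<open>\<beta> T\<close>.\<close>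

lemma recurrent_disjoint_translates:
  assumes act: "group_action G (UNIV :: 'x set) \<phi>" and pe: "pseudo_ergodic G \<phi> M V"
    and ab: "a \<in> M" "b \<in> M" "a \<noteq> b" and F: "finite F" "F \<noteq> {}" and "\<epsilon> > 0"
  obtains T where "T \<subseteq> carrier G" "finite T" "card T = n" "disjoint_family_on (\<lambda>\<gamma>. \<phi> \<gamma> ` F) T"
    "\<And>\<gamma> x. \<gamma> \<in> T \<Longrightarrow> x \<in> F \<Longrightarrow> norm (V (\<phi> \<gamma> x) - V x) < \<epsilon>"
proof -
  interpret group_action G "UNIV :: 'x set" \<phi> by fact
  interpret group G using group_hom group_hom.axioms(1) by blast
  obtain T where T: "T \<subseteq> carrier G" "finite T" "card T = n" "disjoint_family_on (\<lambda>\<gamma>. \<phi> \<gamma> ` F) T"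
    using many_disjoint_translates[OF act pe ab F] by metis
  define W where "W y = V (\<phi> (inv\<^bsub>G\<^esub> (SOME \<gamma>. \<gamma> \<in> T \<and> y \<in> \<phi> \<gamma> ` F)) y)" for y
  have W: "W (\<phi> \<gamma> x) = V x" if "\<gamma> \<in> T" "x \<in> F" for \<gamma> x
  proof -
    have "(SOME \<delta>. \<delta> \<in> T \<and> \<phi> \<gamma> x \<in> \<phi> \<delta> ` F) = \<gamma>"
    proof (rule some_equality)
      show "\<delta> = \<gamma>" if "\<delta> \<in> T \<and> \<phi> \<gamma> x \<in> \<phi> \<delta> ` F" for \<delta>
        using T(4) that \<open>\<gamma> \<in> T\<close> \<open>x \<in> F\<close> unfolding disjoint_family_on_def by blast
    qed (use that in blast)
    then show ?thesis unfolding W_def using action_inv[OF act] that T(1) by auto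
  qed
  have "finite (\<Union>\<gamma>\<in>T. \<phi> \<gamma> ` F)" "\<forall>y\<in>(\<Union>\<gamma>\<in>T. \<phi> \<gamma> ` F). W y \<in> M"
    using T(2) F(1) pe by (auto simp: W_def pseudo_ergodic_def)
  then obtain \<beta> where \<beta>: "\<beta> \<in> carrier G"
    "\<And>y. y \<in> (\<Union>\<gamma>\<in>T. \<phi> \<gamma> ` F) \<Longrightarrow> norm (W y - V (\<phi> \<beta> y)) < \<epsilon>"
    using pe \<open>\<epsilon> > 0\<close> unfolding pseudo_ergodic_def by metis
  have comp: "\<phi> (\<beta> \<otimes>\<^bsub>G\<^esub> \<gamma>) x = \<phi> \<beta> (\<phi> \<gamma> x)" if "\<gamma> \<in> T" for \<gamma> x
    using composition_rule[of x \<beta> \<gamma>] \<beta>(1) T(1) that by blast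
  show ?thesis
  proof (rule that[of "(\<lambda>\<gamma>. \<beta> \<otimes>\<^bsub>G\<^esub> \<gamma>) ` T"])
    show "(\<lambda>\<gamma>. \<beta> \<otimes>\<^bsub>G\<^esub> \<gamma>) ` T \<subseteq> carrier G" using \<beta>(1) T(1) by auto
    show "finite ((\<lambda>\<gamma>. \<beta> \<otimes>\<^bsub>G\<^esub> \<gamma>) ` T)" using T(2) by simp
    have "inj_on (\<lambda>\<gamma>. \<beta> \<otimes>\<^bsub>G\<^esub> \<gamma>) T"
      using T(1) \<beta>(1) by (intro inj_onI) (auto simp: subset_iff)
    then show "card ((\<lambda>\<gamma>. \<beta> \<otimes>\<^bsub>G\<^esub> \<gamma>) ` T) = n" using T(3) by (simp add: card_image)
    have "\<phi> (\<beta> \<otimes>\<^bsub>G\<^esub> \<gamma>) ` F \<inter> \<phi> (\<beta> \<otimes>\<^bsub>G\<^esub> \<delta>) ` F = {}" if "\<gamma> \<in> T" "\<delta> \<in> T" "\<gamma> \<noteq> \<delta>" for \<gamma> \<delta>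
    proof -
      have "\<phi> \<gamma> ` F \<inter> \<phi> \<delta> ` F = {}" using T(4) that unfolding disjoint_family_on_def by blast
      moreover have "inj (\<phi> \<beta>)" using inj_prop[OF \<beta>(1)] .
      ultimately have "\<phi> \<beta> ` (\<phi> \<gamma> ` F) \<inter> \<phi> \<beta> ` (\<phi> \<delta> ` F) = {}"
        by (simp flip: image_Int)
      then show ?thesis using comp that by (simp add: image_image)
    qed
    then show "disjoint_family_on (\<lambda>\<gamma>. \<phi> \<gamma> ` F) ((\<lambda>\<gamma>. \<beta> \<otimes>\<^bsub>G\<^esub> \<gamma>) ` T)"
      unfolding disjoint_family_on_def by blast
    show "norm (V (\<phi> \<gamma> x) - V x) < \<epsilon>"
      if \<gamma>: "\<gamma> \<in> (\<lambda>\<gamma>. \<beta> \<otimes>\<^bsub>G\<^esub> \<gamma>) ` T" and x: "x \<in> F" for \<gamma> x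
    proof -
      obtain \<delta> where \<delta>: "\<delta> \<in> T" "\<gamma> = \<beta> \<otimes>\<^bsub>G\<^esub> \<delta>" using \<gamma> by blast
      then have "norm (W (\<phi> \<delta> x) - V (\<phi> \<beta> (\<phi> \<delta> x))) < \<epsilon>" using x by (intro \<beta>(2)) blast
      then show ?thesis using \<delta> W x comp by (simp add: norm_minus_commute)
    qed
  qed
qed

lemma orthonormal_recurrent_translates:
  fixes f :: "('x, 'k::complex_inner) ell2"
  assumes act: "group_action G (UNIV :: 'x set) \<phi>" and pe: "pseudo_ergodic G \<phi> M V"
    and ab: "a \<in> M" "b \<in> M" "a \<noteq> b" and "\<epsilon> > 0"
    and F: "finite F" "\<And>x. x \<notin> F \<Longrightarrow> Rep_ell2 f x = 0" and f: "norm f = 1"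
  obtains E where "finite E" "orthonormal E" "card E = n"
    "\<And>e. e \<in> E \<Longrightarrow> \<exists>\<gamma>\<in>carrier G. e = translation G \<phi> \<gamma> f \<and> (\<forall>x\<in>F. norm (V (\<phi> \<gamma> x) - V x) < \<epsilon>)"
proof -
  have "F \<noteq> {}"
  proof
    assume "F = {}"
    then have "f = 0" using F(2) by (intro ell2_eqI) (simp add: zero_ell2.rep_eq)
    then show False using f by simp
  qed
  then obtain T where T: "T \<subseteq> carrier G" "finite T" "card T = n" "disjoint_family_on (\<lambda>\<gamma>. \<phi> \<gamma> ` F) T"
    "\<And>\<gamma> x. \<gamma> \<in> T \<Longrightarrow> x \<in> F \<Longrightarrow> norm (V (\<phi> \<gamma> x) - V x) < \<epsilon>"
    using recurrent_disjoint_translates[OF act pe ab F(1) _ \<open>\<epsilon> > 0\<close>] by metis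
  let ?U = "\<lambda>\<gamma>. translation G \<phi> \<gamma> f"
  have orth: "cinner (?U \<gamma>) (?U \<delta>) = (if \<gamma> = \<delta> then 1 else 0)" if \<gamma>\<delta>: "\<gamma> \<in> T" "\<delta> \<in> T" for \<gamma> \<delta>
  proof (cases "\<gamma> = \<delta>")
    case True
    have "cinner (?U \<delta>) (?U \<delta>) = cinner f f"
      by (rule cinner_translation[OF act subsetD[OF T(1) \<gamma>\<delta>(2)]])
    then show ?thesis using True f by (simp only: cinner_self[of f]) simp
  next
    case False
    have g: "\<gamma> \<in> carrier G" "\<delta> \<in> carrier G" using \<gamma>\<delta> T(1) by auto
    have "Rep_ell2 (?U \<gamma>) x = 0 \<or> Rep_ell2 (?U \<delta>) x = 0" for x
    proof (rule ccontr)
      assume "\<not> ?thesis"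
      then have "\<phi> (inv\<^bsub>G\<^esub> \<gamma>) x \<in> F" "\<phi> (inv\<^bsub>G\<^esub> \<delta>) x \<in> F"
        using F(2) by (auto simp: Rep_translation[OF act] g)
      then have "x \<in> \<phi> \<gamma> ` F" "x \<in> \<phi> \<delta> ` F"
        using action_inv(1)[OF act g(1), of x] action_inv(1)[OF act g(2), of x] by (metis imageI)+
      then show False using T(4) \<gamma>\<delta> False unfolding disjoint_family_on_def by blast
    qed
    then have "cinner (Rep_ell2 (?U \<gamma>) x) (Rep_ell2 (?U \<delta>) x) = 0" for x
      by (metis cinner_zero_left cinner_zero_right)
    then show ?thesis using False by (simp add: cinner_ell2.rep_eq)
  qed
  have inj: "inj_on ?U T"
  proof (rule inj_onI, rule ccontr)
    fix \<gamma> \<delta> assume "\<gamma> \<in> T" "\<delta> \<in> T" "?U \<gamma> = ?U \<delta>" "\<gamma> \<noteq> \<delta>"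
    then show False using orth[of \<gamma> \<delta>] orth[of \<gamma> \<gamma>] by simp
  qed
  show ?thesis
  proof (rule that[of "?U ` T"])
    show "orthonormal (?U ` T)"
      unfolding orthonormal_def by (auto simp: orth dest: inj_onD[OF inj])
    show "card (?U ` T) = n" using inj T(3) by (simp add: card_image)
    show "\<exists>\<gamma>\<in>carrier G. e = ?U \<gamma> \<and> (\<forall>x\<in>F. norm (V (\<phi> \<gamma> x) - V x) < \<epsilon>)" if "e \<in> ?U ` T" for e
      using that T(1,5) by blast
  qed (use T(2) in simp)
qed

section \<open>Absence of inessential spectrum\<close>

theorem theorem9:
  fixes G :: "('g, 'm) monoid_scheme"
    and \<phi> :: "'g \<Rightarrow> 'x::countable \<Rightarrow> 'x"
    and H0 :: "('x, complex) ell2 \<Rightarrow> ('x, complex) ell2"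
    and M :: "('k::chilbert_space \<Rightarrow>\<^sub>L 'k) set"
    and V :: "'x \<Rightarrow> 'k \<Rightarrow>\<^sub>L 'k"
    and H :: "('x, 'k) ell2 \<Rightarrow> ('x, 'k) ell2"
  assumes "group_action G UNIV \<phi>"
    and "bounded_clinear H0"
    and "\<And>\<gamma> f. \<gamma> \<in> carrier G \<Longrightarrow> H0 (translation G \<phi> \<gamma> f) = translation G \<phi> \<gamma> (H0 f)"
    and "M \<subseteq> bounded_operators" and "closed M" and "bounded M"
    and "\<exists>A\<in>M. \<exists>B\<in>M. A \<noteq> B"
    and "pseudo_ergodic G \<phi> M V"
    and "H = (\<lambda>f. tensor_id H0 f + mult_op V f)"
  shows "spectrum H \<subseteq> essential_spectrum H"
proof
  note act = assms(1) and H0 = assms(2) and pe = assms(8)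
  obtain a b where ab: "a \<in> M" "b \<in> M" "a \<noteq> b" using assms(7) by blast
  fix z assume z: "z \<in> spectrum H"
  define A where "A f = H f - z *\<^sub>C f" for f
  have bV: "bounded (range V)" using pe assms(6) by (auto simp: pseudo_ergodic_def intro: bounded_subset)
  define D where "D \<gamma> x = V (\<phi> \<gamma> x) - V x" for \<gamma> x
  have bVt: "bounded (range (\<lambda>x. V (\<phi> \<gamma> x)))" for \<gamma> by (rule bounded_subset[OF bV]) auto
  have bD: "bounded (range (D \<gamma>))" for \<gamma>
    unfolding D_def by (intro bounded_minus_comp bV bVt)
  \<comment> \<open>Moving a translation past \<open>A\<close> only replaces \<open>V\<close> by its translate.\<close>
  have AU: "A (translation G \<phi> \<gamma> f) = translation G \<phi> \<gamma> (A f + mult_op (D \<gamma>) f)"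
    if \<gamma>: "\<gamma> \<in> carrier G" for \<gamma> f
  proof -
    have "mult_op (\<lambda>x. V (\<phi> \<gamma> x)) f = mult_op V f + mult_op (D \<gamma>) f"
      by (intro ell2_eqI)
         (simp add: Rep_mult_op[OF bV] Rep_mult_op[OF bVt] Rep_mult_op[OF bD] plus_ell2.rep_eq D_def
           blinfun.diff_left)
    then show ?thesis
      by (simp add: A_def assms(9) tensor_id_translation[OF act \<gamma> H0 assms(3)[OF \<gamma>]]
          mult_op_translation[OF act \<gamma> bV] translation_add[OF act \<gamma>] translation_diff[OF act \<gamma>]
          translation_scaleC[OF act \<gamma>])
  qed
  show "z \<in> essential_spectrum H"
  proof (rule ccontr)
    assume "z \<notin> essential_spectrum H"
    then have fr: "fredholm A" unfolding essential_spectrum_def A_def by simp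
    then interpret A: bounded_linear A by (simp add: fredholm_def bounded_clinear_def)
    obtain K where K: "K > 0" "\<And>h. norm (A h) \<le> K * norm h"
      using A.pos_bounded by (metis mult.commute)
    show False
      using fr[unfolded A_def] z
    proof (cases rule: fredholm_spectrum_cases)
      case (1 f)
      obtain \<delta> N where \<delta>: "\<delta> > 0" and N: "\<And>E. finite E \<Longrightarrow> orthonormal E \<Longrightarrow>
        (\<And>g. g \<in> E \<Longrightarrow> norm (A g) \<le> \<delta>) \<Longrightarrow> card E \<le> N"
        using fredholm_almost_kernel_card_le[OF fr] by metis
      \<comment> \<open>Half of \<open>\<delta>\<close> is spent on the truncation, the other half on the change of the potential.\<close>
      have "\<delta> / (2 * K) > 0" using \<delta> K(1) by simp
      then obtain F f' where F: "finite F" "\<And>x. x \<notin> F \<Longrightarrow> Rep_ell2 f' x = 0"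
        and f': "norm f' = 1" "norm (f' - f) \<le> \<delta> / (2 * K)"
        using finitely_supported_unit_approx[OF 1(1)] by metis
      have "A f = 0" using 1(2) by (simp only: A_def)
      then have "A f' = A (f' - f)" by (simp add: A.diff)
      also have "norm \<dots> \<le> K * (\<delta> / (2 * K))"
        using K(2)[of "f' - f"] mult_left_mono[OF f'(2), of K] K(1) by linarith
      finally have Af': "norm (A f') \<le> \<delta> / 2" using K(1) by simp
      have "\<delta> / 2 > 0" using \<delta> by simp
      then obtain E where E: "finite E" "orthonormal E" "card E = Suc N"
        "\<And>e. e \<in> E \<Longrightarrow> \<exists>\<gamma>\<in>carrier G. e = translation G \<phi> \<gamma> f' \<and> (\<forall>x\<in>F. norm (V (\<phi> \<gamma> x) - V x) < \<delta> / 2)"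
        using orthonormal_recurrent_translates[OF act pe ab _ F f'(1)] by metis
      have "norm (A e) \<le> \<delta>" if e: "e \<in> E" for e
      proof -
        obtain \<gamma> where \<gamma>: "\<gamma> \<in> carrier G" "e = translation G \<phi> \<gamma> f'"
          "\<forall>x\<in>F. norm (V (\<phi> \<gamma> x) - V x) < \<delta> / 2" using E(4)[OF e] by blast
        have "norm (A e) = norm (A f' + mult_op (D \<gamma>) f')"
          by (simp add: \<gamma>(2) AU[OF \<gamma>(1)] norm_translation[OF act \<gamma>(1)])
        also have "\<dots> \<le> norm (A f') + norm (mult_op (D \<gamma>) f')" by (rule norm_triangle_ineq)
        also have "norm (mult_op (D \<gamma>) f') \<le> \<delta> / 2 * norm f'"
          using \<gamma>(3) \<delta> F(2) by (intro norm_mult_op_le_on_support(1)[OF bD, of F]) (auto simp: D_def less_imp_le)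
        finally show ?thesis using Af' f'(1) by simp
      qed
      then show False using N[OF E(1,2)] E(3) by simp
    next
      case 2
      obtain \<delta> N where \<delta>: "\<delta> > 0" and N: "\<And>E. finite E \<Longrightarrow> orthonormal E \<Longrightarrow>
        (\<And>g h. g \<in> E \<Longrightarrow> norm (cinner g (A h)) \<le> \<delta> * norm h) \<Longrightarrow> card E \<le> N"
        using fredholm_almost_cokernel_card_le[OF fr] by metis
      \<comment> \<open>A quarter of \<open>\<delta>\<close> for \<open>g\<close>, a quarter for its truncation, and half for the change of the potential.\<close>
      have "\<delta> / 4 > 0" using \<delta> by simp
      then obtain g where g: "norm g = 1" "\<And>h. norm (cinner g (A h)) \<le> \<delta> / 4 * norm h"
        using 2 unfolding A_def by blast
      have "\<delta> / (4 * K) > 0" using \<delta> K(1) by simp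
      then obtain F g' where F: "finite F" "\<And>x. x \<notin> F \<Longrightarrow> Rep_ell2 g' x = 0"
        and g': "norm g' = 1" "norm (g' - g) \<le> \<delta> / (4 * K)"
        using finitely_supported_unit_approx[OF g(1)] by metis
      have Ag': "norm (cinner g' (A h)) \<le> \<delta> / 2 * norm h" for h
      proof -
        have "cinner g' (A h) = cinner g (A h) + cinner (g' - g) (A h)"
          by (simp flip: cinner_add_left)
        then have "norm (cinner g' (A h)) \<le> norm (cinner g (A h)) + norm (cinner (g' - g) (A h))"
          by (simp add: norm_triangle_ineq)
        also have "norm (cinner (g' - g) (A h)) \<le> norm (g' - g) * norm (A h)"
          by (rule norm_cinner_le)
        also have "\<dots> \<le> \<delta> / (4 * K) * (K * norm h)"
          using g'(2) K \<delta> by (intro mult_mono) auto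
        finally show ?thesis using g(2)[of h] K(1) by simp
      qed
      have "\<delta> / 2 > 0" using \<delta> by simp
      then obtain E where E: "finite E" "orthonormal E" "card E = Suc N"
        "\<And>e. e \<in> E \<Longrightarrow> \<exists>\<gamma>\<in>carrier G. e = translation G \<phi> \<gamma> g' \<and> (\<forall>x\<in>F. norm (V (\<phi> \<gamma> x) - V x) < \<delta> / 2)"
        using orthonormal_recurrent_translates[OF act pe ab _ F g'(1)] by metis
      have "norm (cinner e (A h)) \<le> \<delta> * norm h" if e: "e \<in> E" for e h
      proof -
        obtain \<gamma> where \<gamma>: "\<gamma> \<in> carrier G" "e = translation G \<phi> \<gamma> g'"
          "\<forall>x\<in>F. norm (V (\<phi> \<gamma> x) - V x) < \<delta> / 2" using E(4)[OF e] by blast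
        define k where "k = translation G \<phi> (inv\<^bsub>G\<^esub> \<gamma>) h"
        have h: "h = translation G \<phi> \<gamma> k"
          by (simp add: k_def translation_translation_inv[OF act \<gamma>(1)])
        have nk: "norm k = norm h" by (simp add: h norm_translation[OF act \<gamma>(1)])
        have "cinner e (A h) = cinner g' (A k) + cinner g' (mult_op (D \<gamma>) k)"
          by (simp add: \<gamma>(2) h AU[OF \<gamma>(1)] cinner_translation[OF act \<gamma>(1)] cinner_add_right)
        then have "norm (cinner e (A h)) \<le> norm (cinner g' (A k)) + norm (cinner g' (mult_op (D \<gamma>) k))"
          by (simp add: norm_triangle_ineq)
        also have "norm (cinner g' (mult_op (D \<gamma>) k)) \<le> \<delta> / 2 * norm g' * norm k"
          using \<gamma>(3) \<delta> F(2) by (intro norm_mult_op_le_on_support(2)[OF bD, of F]) (auto simp: D_def less_imp_le)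
        finally show ?thesis using Ag'[of k] g'(1) nk by simp
      qed
      then show False using N[OF E(1,2)] E(3) by simp
    qed
  qed
qed

end
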